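(* Let $n\ge 1$, let $\Omega\subset\mathbb{R}^n$ be a bounded open set with $C^{1,\gamma}$-boundary (for some $\gamma\in(0,1)$), and let $E\subseteq\mathbb{R}^n$ be a measurable set. Suppose that $\mathrm{Per}_{s_0}(E;\Omega)<\infty$ for some $s_0\in(0,1)$. Then: (i) If $|\Omega\setminus E|=|E\cap\Omega|$, then the limit $\mu(E):=\lim_{s\searrow0}s\,\mathrm{Per}_s(E;\Omega)$ exists (that is, $E\in\mathcal{E}$) and $\mu(E)=\mathcal{M}(E\cap\Omega)$. (ii) If $|\Omega\setminus E|\neq|E\cap\Omega|$ and $E\in\mathcal{E}$ (that is, the limit $\mu(E)$ exists), then the limit $$\alpha(E):=\lim_{s\searrow 0}\, s\int_{E\cap(\mathbb{R}^n\setminus B_1)}\frac{1}{|y|^{n+s}}\,dy$$ exists and $$\alpha(E)=\frac{\mu(E)-\mathcal{M}(E\cap\Omega)}{|\Omega\setminus E|-|E\cap\Omega|}.$$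
   Context: For $s\in(0,1)$ and measurable $A,B\subseteq\mathbb{R}^n$, set $L(A,B):=\int_A\int_B\frac{1}{|x-y|^{n+s}}\,dx\,dy\in[0,+\infty]$ (with $L(A,B)=0$ if $A$ or $B$ is empty). Write $\mathcal{C}E=\mathbb{R}^n\setminus E$. The $s$-perimeter of a measurable set $E\subseteq\mathbb{R}^n$ in $\Omega$ is $$\mathrm{Per}_s(E;\Omega):=L(E\cap\Omega,(\mathcal{C}E)\cap\Omega)+L(E\cap\Omega,(\mathcal{C}E)\cap(\mathcal{C}\Omega))+L(E\cap(\mathcal{C}\Omega),(\mathcal{C}E)\cap\Omega).$$ $\mathcal{E}$ denotes the family of sets $E\subseteq\mathbb{R}^n$ for which the limit $\mu(E):=\lim_{s\searrow0}s\,\mathrm{Per}_s(E;\Omega)$ exists (as a finite number). $B_1$ is the open unit ball centered at $0$. $\mathcal{H}^{n-1}(S^{n-1})$ is the $(n-1)$-dimensional Hausdorff measure of the unit sphere of $\mathbb{R}^n$, $|A|$ is the Lebesgue measure of $A$, and $\mathcal{M}(A):=\mathcal{H}^{n-1}(S^{n-1})\,|A|$. *)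

theory Defs
  imports "HOL-Analysis.Analysis"
begin

text \<open>On the diagonal \<open>x = y\<close> the kernel below evaluates to \<open>0\<close> (division by zero) rather than to
  infinity. The inner integral is over a set in dimension at least one, so this only concerns a null
  set and does not affect the value.\<close>

definition interaction :: "real \<Rightarrow> 'a::euclidean_space set \<Rightarrow> 'a set \<Rightarrow> ennreal" where
  "interaction s A B =
     (\<integral>\<^sup>+x\<in>A. (\<integral>\<^sup>+y\<in>B. ennreal (1 / norm (x - y) powr (real DIM('a) + s)) \<partial>lebesgue) \<partial>lebesgue)"

definition s_perimeter :: "real \<Rightarrow> 'a::euclidean_space set \<Rightarrow> 'a set \<Rightarrow> ennreal" where
  "s_perimeter s E \<Omega> =
     interaction s (E \<inter> \<Omega>) (- E \<inter> \<Omega>)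
     + interaction s (E \<inter> \<Omega>) (- E \<inter> - \<Omega>)
     + interaction s (E \<inter> - \<Omega>) (- E \<inter> \<Omega>)"

text \<open>The family of measurable sets for which \<open>s Per\<^sub>s(E; \<Omega>)\<close> has a finite limit
  as \<open>s\<close> decreases to \<open>0\<close>, and the limit itself (meaningful only for members of the family).\<close>

definition limit_family :: "'a::euclidean_space set \<Rightarrow> 'a set set" where
  "limit_family \<Omega> =
     {E \<in> sets lebesgue.
        \<exists>m. m < \<infinity> \<and> ((\<lambda>s. ennreal s * s_perimeter s E \<Omega>) \<longlongrightarrow> m) (at_right 0)}"

definition limit_perimeter :: "'a::euclidean_space set \<Rightarrow> 'a set \<Rightarrow> ennreal" where
  "limit_perimeter \<Omega> E = Lim (at_right 0) (\<lambda>s. ennreal s * s_perimeter s E \<Omega>)"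

text \<open>Hausdorff measure of integer dimension \<open>d\<close>, normalised by the volume of the \<open>d\<close>-dimensional
  unit ball. The empty set gets weight \<open>0\<close> and every other set the weight
  \<open>\<omega>\<^sub>d (diam / 2)\<^sup>d\<close>, where the natural power \<open>0 ^ 0 = 1\<close> makes the case \<open>d = 0\<close> the counting
  measure. Boundedness is required because \<open>diameter\<close> is unspecified on unbounded sets.\<close>

definition hausdorff_weight :: "nat \<Rightarrow> 'a::metric_space set \<Rightarrow> ennreal" where
  "hausdorff_weight d U =
     (if U = {} then 0 else ennreal (unit_ball_vol (real d) * (diameter U / 2) ^ d))"

definition hausdorff_content :: "nat \<Rightarrow> real \<Rightarrow> 'a::metric_space set \<Rightarrow> ennreal" where
  "hausdorff_content d \<delta> A =
     (INF U \<in> {U :: nat \<Rightarrow> 'a set.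
                 A \<subseteq> (\<Union>i. U i) \<and> (\<forall>i. bounded (U i) \<and> diameter (U i) \<le> \<delta>)}.
        \<Sum>i. hausdorff_weight d (U i))"

definition hausdorff_measure :: "nat \<Rightarrow> 'a::metric_space set \<Rightarrow> ennreal" where
  "hausdorff_measure d A = (SUP \<delta> \<in> {0<..}. hausdorff_content d \<delta> A)"

definition sphere_weighted_measure :: "'a::euclidean_space set \<Rightarrow> ennreal" where
  "sphere_weighted_measure A =
     hausdorff_measure (DIM('a) - 1) (sphere (0 :: 'a) 1) * emeasure lebesgue A"

definition C1_holder_on :: "real \<Rightarrow> 'a::euclidean_space set \<Rightarrow> ('a \<Rightarrow> real) \<Rightarrow> bool" where
  "C1_holder_on \<gamma> S f \<longleftrightarrow>
     (\<exists>g. (\<forall>x\<in>S. (f has_derivative (\<lambda>h. g x \<bullet> h)) (at x)) \<and>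
          (\<exists>C. \<forall>x\<in>S. \<forall>y\<in>S. norm (g x - g y) \<le> C * norm (x - y) powr \<gamma>))"

text \<open>Near every boundary point, and in suitable orthonormal coordinates, the set is the strict
  epigraph of a \<open>C\<^sup>1\<^sup>,\<^sup>\<gamma>\<close> function over the hyperplane orthogonal to a unit vector \<open>v\<close>. A function on
  that hyperplane is represented by its extension to the whole space that is constant in direction
  \<open>v\<close>, namely \<open>\<phi>\<close> composed with the orthogonal projection. In dimension one the hyperplane is a
  point and \<open>\<phi>\<close> contributes a constant.\<close>

definition C1_holder_boundary :: "real \<Rightarrow> 'a::euclidean_space set \<Rightarrow> bool" where
  "C1_holder_boundary \<gamma> \<Omega> \<longleftrightarrow>
     (\<forall>x \<in> frontier \<Omega>. \<exists>r>0. \<exists>v \<phi>. norm v = 1 \<and>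
        C1_holder_on \<gamma> (ball x r) (\<lambda>y. \<phi> (y - (y \<bullet> v) *\<^sub>R v)) \<and>
        \<Omega> \<inter> ball x r = {y \<in> ball x r. \<phi> (y - (y \<bullet> v) *\<^sub>R v) < y \<bullet> v})"

end

theory Submission
  imports Defs
begin

text \<open>Let \<open>N = n \<omega>\<^sub>n\<close> with \<open>\<omega>\<^sub>n\<close> the volume of the unit ball. For bounded \<open>A\<close>, the part of
  \<open>s L(A, B)\<close> that comes from a bounded part of \<open>B\<close> vanishes as \<open>s\<close> decreases to \<open>0\<close>, because the kernel there is
  dominated by the integrable one with exponent \<open>s\<^sub>0\<close>; far away \<open>|x - y|\<close> is comparable to \<open>|y|\<close> with
  ratio tending to \<open>1\<close>, so \<open>s L(A, B) = |A| \<alpha>\<^sub>s(B) + o(1)\<close> with \<open>\<alpha>\<^sub>s(B)\<close> equal to \<open>s\<close> times the integral of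
  \<open>|y| powr (- n - s)\<close> over \<open>B\<close> outside the unit ball. Since
  \<open>\<alpha>\<^sub>s(E) + \<alpha>\<^sub>s(- E) = N\<close>, the rescaled perimeter is
  \<open>|E \<inter> \<Omega>| N + (|\<Omega> - E| - |E \<inter> \<Omega>|) \<alpha>\<^sub>s(E) + o(1)\<close>, and both claims follow.

  It remains to see that the Hausdorff measure of the unit sphere is \<open>N\<close>. For the lower bound, the cone
  over a small piece of the sphere is cut by hyperplanes orthogonal to a point of the piece; the
  isodiametric inequality in dimension \<open>n - 1\<close>, proved by Steiner symmetrization, bounds the slices.
  For the upper bound, Vitali's theorem fills the shell \<open>1/2 < |x| < 1\<close> with small disjoint balls up to a
  null set, which small balls of tiny total volume cover. Each sphere of radius \<open>t\<close> in the shell meets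
  these balls in caps, which rescale to a cover of the unit sphere; averaging the resulting bound over
  \<open>t\<close> turns the sum of the weights of the caps into the volume of the shell.\<close>

section \<open>The isodiametric inequality\<close>

text \<open>\<open>Y\<close> lies in \<open>{Inf Y..Sup Y}\<close>, and each point of
  \<open>X\<close> is within \<open>c\<close> of both ends, so \<open>X\<close> lies in
  \<open>{Sup Y - c..Inf Y + c}\<close>; the two lengths add up to exactly \<open>2 * c\<close>. It
  is applied to two parallel sections of a set of bounded diameter.\<close>

lemma emeasure_add_le_of_mutual_distance:
  fixes X Y :: "real set"
  assumes ne: "X \<noteq> {}" "Y \<noteq> {}" and le: "\<And>x y. x \<in> X \<Longrightarrow> y \<in> Y \<Longrightarrow> \<bar>x - y\<bar> \<le> c"
  shows "emeasure lborel X + emeasure lborel Y \<le> ennreal (2 * c)"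
proof -
  obtain x0 y0 where xy: "x0 \<in> X" "y0 \<in> Y" using ne by blast
  have bY: "bdd_above Y" "bdd_below Y"
    using le[OF xy(1)] by (auto simp: abs_le_iff intro!: bdd_aboveI[where M="x0 + c"] bdd_belowI[where m="x0 - c"])
       (smt (verit) le xy(1))+
  have Ysub: "Y \<subseteq> {Inf Y..Sup Y}"
    using bY by (auto intro: cInf_lower cSup_upper)
  have Xsub: "X \<subseteq> {Sup Y - c..Inf Y + c}"
  proof
    fix x assume x: "x \<in> X"
    have "Sup Y \<le> x + c"
      by (rule cSup_least[OF ne(2)]) (use le[OF x] in \<open>auto simp: abs_le_iff\<close>, smt (verit) le x)
    moreover have "x - c \<le> Inf Y"
      by (rule cInf_greatest[OF ne(2)]) (use le[OF x] in \<open>auto simp: abs_le_iff\<close>, smt (verit) le x)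
    ultimately show "x \<in> {Sup Y - c..Inf Y + c}" by auto
  qed
  have 1: "Sup Y - c \<le> Inf Y + c" "Inf Y \<le> Sup Y" using Xsub Ysub xy by force+
  have "emeasure lborel X \<le> ennreal (Inf Y + c - (Sup Y - c))"
    using emeasure_mono[OF Xsub, of lborel] 1 by simp
  moreover have "emeasure lborel Y \<le> ennreal (Sup Y - Inf Y)"
    using emeasure_mono[OF Ysub, of lborel] 1 by simp
  ultimately have "emeasure lborel X + emeasure lborel Y
      \<le> ennreal (Inf Y + c - (Sup Y - c)) + ennreal (Sup Y - Inf Y)"
    by (rule add_mono)
  also have "\<dots> = ennreal (2 * c)"
    using 1 by (subst ennreal_plus[symmetric]) auto
  finally show ?thesis .
qed

text \<open>Null sections are dropped from the symmetrized set, so that an empty section does not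
  contribute the origin.\<close>

lemma steiner_symmetrization:
  fixes A :: "'i set" and U :: "('i \<Rightarrow> real) set"
  assumes fin: "finite A" and i: "i \<in> A" and U: "U \<in> sets (Pi\<^sub>M A (\<lambda>_. lborel))" and D: "0 \<le> D"
    and diam: "\<And>f g. f \<in> U \<Longrightarrow> g \<in> U \<Longrightarrow> (\<Sum>j\<in>A. (f j - g j)\<^sup>2) \<le> D\<^sup>2"
  shows "\<exists>V\<in>sets (Pi\<^sub>M A (\<lambda>_. lborel)).
    emeasure (Pi\<^sub>M A (\<lambda>_. lborel)) V = emeasure (Pi\<^sub>M A (\<lambda>_. lborel)) U \<and>
    (\<forall>f\<in>V. \<forall>g\<in>V. (\<Sum>j\<in>A. (f j - g j)\<^sup>2) \<le> D\<^sup>2) \<and>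
    (\<forall>f\<in>V. f(i := - f i) \<in> V) \<and>
    (\<forall>j\<in>A. (\<forall>f\<in>U. f(j := - f j) \<in> U) \<longrightarrow> (\<forall>f\<in>V. f(j := - f j) \<in> V))"
proof -
  interpret product_sigma_finite "\<lambda>_::'i. lborel :: real measure" by standard
  define P where "P = (Pi\<^sub>M A (\<lambda>_. lborel) :: ('i \<Rightarrow> real) measure)"
  define A' where "A' = A - {i}"
  have A: "A = insert i A'" "i \<notin> A'" "finite A'" using fin i by (auto simp: A'_def)
  define sec where "sec f = {t. f(i := t) \<in> U}" for f :: "'i \<Rightarrow> real"
  define m where "m f = emeasure lborel (sec f)" for f
  \<comment> \<open>Over each \<open>f\<close> the section of \<open>U\<close> is replaced by the
    closed interval of the same length \<open>m f\<close> centred at 0. Neither \<open>sec f\<close>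
    nor \<open>m f\<close> depends on the value \<open>f i\<close>.\<close>
  define V where "V = {f \<in> space P. 0 < m f \<and> ennreal (2 * \<bar>f i\<bar>) \<le> m f}"
  have insA: "insert i A = A" using i by auto
  have upd: "(\<lambda>(f, t). f(i := t)) \<in> measurable (P \<Otimes>\<^sub>M lborel) P"
    using measurable_add_dim[of i A "\<lambda>_. lborel"] unfolding insA P_def .
  have UP: "U \<in> sets P" using U by (simp add: P_def)
  have upd_space: "f(i := t) \<in> space P" if "f \<in> space P" for f t
    using that i by (auto simp: P_def space_PiM PiE_def extensional_def)
  have upd_meas: "(\<lambda>t. f(i := t)) \<in> measurable lborel P" if "f \<in> space P" for f
    using measurable_compose[OF measurable_Pair1'[OF that, of lborel] upd] by simp
  have sec_meas: "sec f \<in> sets borel" if "f \<in> space P" for f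
    using measurable_sets[OF upd_meas[OF that] UP] by (simp add: sec_def vimage_def)
  have m_eq: "m f = (\<integral>\<^sup>+t. indicator U (f(i := t)) \<partial>lborel)" if "f \<in> space P" for f
  proof -
    have "m f = (\<integral>\<^sup>+t. indicator (sec f) t \<partial>lborel)"
      unfolding m_def using sec_meas[OF that] by simp
    also have "\<dots> = (\<integral>\<^sup>+t. indicator U (f(i := t)) \<partial>lborel)"
      by (intro nn_integral_cong) (auto simp: sec_def indicator_def)
    finally show ?thesis .
  qed
  have "(\<lambda>f. \<integral>\<^sup>+t. indicator U (f(i := t)) \<partial>lborel) \<in> borel_measurable P"
  proof (rule lborel.borel_measurable_nn_integral)
    have "(\<lambda>x. indicator U (case x of (f, t) \<Rightarrow> f(i := t)) :: ennreal) \<in> borel_measurable (P \<Otimes>\<^sub>M lborel)"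
      by (rule measurable_compose[OF upd]) (use UP in auto)
    then show "(\<lambda>(f, t). indicator U (f(i := t)) :: ennreal) \<in> borel_measurable (P \<Otimes>\<^sub>M lborel)"
      by (simp add: case_prod_unfold)
  qed
  then have m_meas: "m \<in> borel_measurable P"
    by (subst measurable_cong[OF m_eq])
  have coord: "(\<lambda>f. f i) \<in> borel_measurable P"
    using measurable_component_singleton[OF i, of "\<lambda>_. lborel"] by (simp add: P_def)
  have V: "V \<in> sets P"
  proof -
    have 1: "(\<lambda>f. ennreal (2 * \<bar>f i\<bar>)) \<in> borel_measurable P"
      by (rule measurable_compose[OF coord]) measurable
    have "V = {f \<in> space P. 0 < m f} \<inter> {f \<in> space P. ennreal (2 * \<bar>f i\<bar>) \<le> m f}"
      by (auto simp: V_def)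
    also have "\<dots> \<in> sets P"
      using 1 m_meas by (intro sets.Int borel_measurable_less borel_measurable_le borel_measurable_const)
    finally show ?thesis .
  qed
  have sec_upd: "sec (f(i := t)) = sec f" for f t by (simp add: sec_def)
  have m_upd: "m (f(i := t)) = m f" for f t by (simp add: m_def sec_upd)
  have sumA: "(\<Sum>j\<in>A. (f j - g j)\<^sup>2) = (f i - g i)\<^sup>2 + (\<Sum>j\<in>A'. (f j - g j)\<^sup>2)" for f g :: "'i \<Rightarrow> real"
    unfolding A(1) using A(2,3) by simp
  have sumA': "(\<Sum>j\<in>A'. ((f(i := x)) j - (g(i := y)) j)\<^sup>2) = (\<Sum>j\<in>A'. (f j - g j)\<^sup>2)"
    for f g :: "'i \<Rightarrow> real" and x y
    using A(2) by (intro sum.cong) auto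
  \<comment> \<open>Points of \<open>U\<close> over \<open>f\<close> and \<open>g\<close> already
    differ by the sum over \<open>A'\<close> in the other coordinates, so in coordinate
    \<open>i\<close> they can differ only by what remains of \<open>D\<^sup>2\<close>.\<close>
  have pair: "m f + m g \<le> ennreal (2 * sqrt (D\<^sup>2 - (\<Sum>j\<in>A'. (f j - g j)\<^sup>2)))"
    if "sec f \<noteq> {}" "sec g \<noteq> {}" for f g
    unfolding m_def
  proof (rule emeasure_add_le_of_mutual_distance[OF that])
    fix x y assume "x \<in> sec f" "y \<in> sec g"
    then have "f(i := x) \<in> U" "g(i := y) \<in> U" by (auto simp: sec_def)
    from diam[OF this] have "(x - y)\<^sup>2 \<le> D\<^sup>2 - (\<Sum>j\<in>A'. (f j - g j)\<^sup>2)"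
      unfolding sumA sumA' by simp
    then show "\<bar>x - y\<bar> \<le> sqrt (D\<^sup>2 - (\<Sum>j\<in>A'. (f j - g j)\<^sup>2))"
      using real_sqrt_le_mono by fastforce
  qed
  have m_fin: "m f < \<infinity>" for f
  proof (cases "sec f = {}")
    case False
    have "m f \<le> m f + m f" by simp
    also note pair[OF False False]
    also have "ennreal (2 * sqrt (D\<^sup>2 - (\<Sum>j\<in>A'. (f j - f j)\<^sup>2))) < \<infinity>" by simp
    finally show ?thesis .
  qed (simp add: m_def)
  have sec_ne: "sec f \<noteq> {}" if "0 < m f" for f using that by (auto simp: m_def)
  have V_diam: "(\<Sum>j\<in>A. (f j - g j)\<^sup>2) \<le> D\<^sup>2" if "f \<in> V" "g \<in> V" for f g
  proof -
    have ne: "sec f \<noteq> {}" "sec g \<noteq> {}" using that sec_ne by (auto simp: V_def)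
    define S where "S = (\<Sum>j\<in>A'. (f j - g j)\<^sup>2)"
    obtain x y where "f(i := x) \<in> U" "g(i := y) \<in> U" using ne by (auto simp: sec_def)
    from diam[OF this] have S: "S \<le> D\<^sup>2"
      unfolding sumA sumA' S_def by (smt (verit) zero_le_power2)
    \<comment> \<open>For centred intervals the largest distance between points is half the sum of
      the lengths, which is the quantity that \<open>pair\<close> controls.\<close>
    have "ennreal (2 * \<bar>f i\<bar>) + ennreal (2 * \<bar>g i\<bar>) \<le> m f + m g"
      using that by (intro add_mono) (auto simp: V_def)
    also have "\<dots> \<le> ennreal (2 * sqrt (D\<^sup>2 - S))" using pair[OF ne] by (simp add: S_def)
    finally have "ennreal (2 * \<bar>f i\<bar> + 2 * \<bar>g i\<bar>) \<le> ennreal (2 * sqrt (D\<^sup>2 - S))"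
      by (simp add: ennreal_plus[symmetric] del: ennreal_plus)
    then have "2 * \<bar>f i\<bar> + 2 * \<bar>g i\<bar> \<le> 2 * sqrt (D\<^sup>2 - S)"
      using S by (subst (asm) ennreal_le_iff) auto
    then have "\<bar>f i - g i\<bar> \<le> sqrt (D\<^sup>2 - S)" by linarith
    then have "\<bar>f i - g i\<bar>\<^sup>2 \<le> (sqrt (D\<^sup>2 - S))\<^sup>2" by (rule power_mono) simp
    then show ?thesis unfolding sumA S_def[symmetric] using S by simp
  qed
  have V_space: "f \<in> space P" if "f \<in> V" for f using that by (auto simp: V_def)
  have V_sym: "f(i := - f i) \<in> V" if "f \<in> V" for f
    using that upd_space by (auto simp: V_def m_upd)
  \<comment> \<open>A reflection in another coordinate that preserves \<open>U\<close> leaves the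
    section, and hence its length, unchanged. So symmetries gained earlier survive.\<close>
  have V_sym': "f(j := - f j) \<in> V" if j: "j \<in> A" and s: "\<And>f. f \<in> U \<Longrightarrow> f(j := - f j) \<in> U" and f: "f \<in> V" for j f
  proof (cases "j = i")
    case False
    have "sec (f(j := - f j)) = sec f"
    proof (intro set_eqI iffI)
      fix t assume "t \<in> sec (f(j := - f j))"
      then have "f(j := - f j, i := t) \<in> U" by (simp add: sec_def)
      have eq: "(f(j := - f j, i := t))(j := - (f(j := - f j, i := t)) j) = f(i := t)"
        using False by (auto simp: fun_eq_iff)
      show "t \<in> sec f"
        using s[OF \<open>f(j := - f j, i := t) \<in> U\<close>] unfolding eq sec_def by blast
    next
      fix t assume "t \<in> sec f"
      then have "f(i := t) \<in> U" by (simp add: sec_def)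
      from s[OF this] show "t \<in> sec (f(j := - f j))" using False by (simp add: sec_def fun_upd_twist)
    qed
    moreover have "f(j := - f j) \<in> space P"
      using V_space[OF f] j by (auto simp: P_def space_PiM PiE_def extensional_def)
    ultimately show ?thesis using f False by (auto simp: V_def m_def)
  qed (use V_sym f in auto)
  have fub: "emeasure P W = (\<integral>\<^sup>+f. (\<integral>\<^sup>+t. indicator W (f(i := t)) \<partial>lborel) \<partial>Pi\<^sub>M A' (\<lambda>_. lborel))"
    if "W \<in> sets P" for W
  proof -
    have "emeasure P W = (\<integral>\<^sup>+f. indicator W f \<partial>P)" using that by simp
    also have "\<dots> = (\<integral>\<^sup>+f. (\<integral>\<^sup>+t. indicator W (f(i := t)) \<partial>lborel) \<partial>Pi\<^sub>M A' (\<lambda>_. lborel))"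
      unfolding P_def A(1)
      by (rule product_nn_integral_insert[OF A(3,2)]) (use that in \<open>auto simp: P_def A(1)\<close>)
    finally show ?thesis .
  qed
  have "(\<integral>\<^sup>+t. indicator V (f(i := t)) \<partial>lborel) = (\<integral>\<^sup>+t. indicator U (f(i := t)) \<partial>lborel)"
    if f: "f \<in> space (Pi\<^sub>M A' (\<lambda>_. lborel))" for f
  proof -
    have sp: "f(i := t) \<in> space P" for t
      using f by (auto simp: P_def A(1) space_PiM PiE_def extensional_def)
    have "(\<integral>\<^sup>+t. indicator U (f(i := t)) \<partial>lborel) = m f"
      using m_eq[OF sp[of 0]] by (simp add: m_upd)
    moreover have "(\<integral>\<^sup>+t. indicator V (f(i := t)) \<partial>lborel) = m f"
    proof (cases "m f = 0")
      case True
      then show ?thesis by (simp add: V_def m_upd)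
    next
      case False
      obtain c where c: "m f = ennreal c" "0 \<le> c"
        using m_fin[of f] by (cases "m f") auto
      have "(\<integral>\<^sup>+t. indicator V (f(i := t)) \<partial>lborel) = (\<integral>\<^sup>+t. indicator {- c / 2..c / 2} t \<partial>lborel)"
      proof (intro nn_integral_cong)
        fix t :: real
        have "f(i := t) \<in> V \<longleftrightarrow> t \<in> {- c / 2..c / 2}"
          using False c sp[of t] by (auto simp: V_def m_upd zero_less_iff_neq_zero)
        then show "(indicator V (f(i := t)) :: ennreal) = indicator {- c / 2..c / 2} t"
          by (auto simp: indicator_def)
      qed
      also have "\<dots> = ennreal c" using c(2) by simp
      finally show ?thesis using c by simp
    qed
    ultimately show ?thesis by simp
  qed
  then have "emeasure P V = emeasure P U"
    unfolding fub[OF V] fub[OF UP] by (rule nn_integral_cong)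
  moreover have "\<forall>j\<in>A. (\<forall>f\<in>U. f(j := - f j) \<in> U) \<longrightarrow> (\<forall>f\<in>V. f(j := - f j) \<in> V)"
    using V_sym' by blast
  moreover have "\<forall>f\<in>V. \<forall>g\<in>V. (\<Sum>j\<in>A. (f j - g j)\<^sup>2) \<le> D\<^sup>2" "\<forall>f\<in>V. f(i := - f i) \<in> V"
    using V_diam V_sym by blast+
  ultimately show ?thesis
    using V unfolding P_def by (intro bexI[of _ V] conjI)
qed

text \<open>Symmetrizing in every coordinate in turn makes the set invariant under the point
  reflection. Then \<open>f\<close> and its mirror image are at most \<open>D\<close> apart, so the
  set lies in the ball of radius \<open>D / 2\<close>.\<close>

lemma isodiametric_PiM_pos:
  fixes A :: "'i set" and U :: "('i \<Rightarrow> real) set"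
  assumes fin: "finite A" and U: "U \<in> sets (Pi\<^sub>M A (\<lambda>_. lborel))" and D: "0 < D"
    and diam: "\<And>f g. f \<in> U \<Longrightarrow> g \<in> U \<Longrightarrow> (\<Sum>j\<in>A. (f j - g j)\<^sup>2) \<le> D\<^sup>2"
  shows "emeasure (Pi\<^sub>M A (\<lambda>_. lborel)) U \<le> ennreal (unit_ball_vol (real (card A)) * (D / 2) ^ card A)"
proof -
  define P where "P = (Pi\<^sub>M A (\<lambda>_. lborel) :: ('i \<Rightarrow> real) measure)"
  \<comment> \<open>Induction on the set \<open>B\<close> of coordinates already symmetrized; the
    last clause of \<open>steiner_symmetrization\<close> protects the symmetries obtained
    before.\<close>
  have "\<exists>V. V \<in> sets P \<and> emeasure P V = emeasure P U \<and>
          (\<forall>f\<in>V. \<forall>g\<in>V. (\<Sum>j\<in>A. (f j - g j)\<^sup>2) \<le> D\<^sup>2) \<and> (\<forall>j\<in>B. \<forall>f\<in>V. f(j := - f j) \<in> V)"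
    if "B \<subseteq> A" for B
    using finite_subset[OF that fin] that
  proof (induction B rule: finite_induct)
    case empty
    then show ?case using U diam by (intro exI[of _ U]) (auto simp: P_def)
  next
    case (insert b B)
    from insert.prems have "B \<subseteq> A" by simp
    from insert.IH[OF this] obtain V where V: "V \<in> sets P" "emeasure P V = emeasure P U"
      "\<forall>f\<in>V. \<forall>g\<in>V. (\<Sum>j\<in>A. (f j - g j)\<^sup>2) \<le> D\<^sup>2" "\<forall>j\<in>B. \<forall>f\<in>V. f(j := - f j) \<in> V"
      by (elim exE conjE) (rule that)
    have b: "b \<in> A" using insert by auto
    have Vd: "(\<Sum>j\<in>A. (f j - g j)\<^sup>2) \<le> D\<^sup>2" if "f \<in> V" "g \<in> V" for f g
      using V(3) that by blast
    have "\<exists>W\<in>sets P. emeasure P W = emeasure P V \<and>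
      (\<forall>f\<in>W. \<forall>g\<in>W. (\<Sum>j\<in>A. (f j - g j)\<^sup>2) \<le> D\<^sup>2) \<and> (\<forall>f\<in>W. f(b := - f b) \<in> W) \<and>
      (\<forall>j\<in>A. (\<forall>f\<in>V. f(j := - f j) \<in> V) \<longrightarrow> (\<forall>f\<in>W. f(j := - f j) \<in> W))"
      unfolding P_def
      by (rule steiner_symmetrization[OF fin b V(1)[unfolded P_def] less_imp_le[OF D]]) (rule Vd)
    then obtain W where W: "W \<in> sets P" "emeasure P W = emeasure P V"
      "\<forall>f\<in>W. \<forall>g\<in>W. (\<Sum>j\<in>A. (f j - g j)\<^sup>2) \<le> D\<^sup>2"
      "\<forall>f\<in>W. f(b := - f b) \<in> W"
      "\<forall>j\<in>A. (\<forall>f\<in>V. f(j := - f j) \<in> V) \<longrightarrow> (\<forall>f\<in>W. f(j := - f j) \<in> W)"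
      by (elim bexE conjE) (rule that)
    have "\<forall>j\<in>insert b B. \<forall>f\<in>W. f(j := - f j) \<in> W"
    proof
      fix j assume j: "j \<in> insert b B"
      show "\<forall>f\<in>W. f(j := - f j) \<in> W"
      proof (cases "j = b")
        case True
        show ?thesis unfolding True by (rule W(4))
      next
        case False
        with j insert.prems have j: "j \<in> B" "j \<in> A" by auto
        from bspec[OF V(4) j(1)] bspec[OF W(5) j(2)] show ?thesis by (rule rev_mp)
      qed
    qed
    moreover have "emeasure P W = emeasure P U" using W(2) V(2) by simp
    ultimately show ?case using W(1,3) by (intro exI[of _ W] conjI)
  qed
  from this[OF order_refl] obtain V where V: "V \<in> sets P" "emeasure P V = emeasure P U"
      "\<forall>f\<in>V. \<forall>g\<in>V. (\<Sum>j\<in>A. (f j - g j)\<^sup>2) \<le> D\<^sup>2" "\<forall>j\<in>A. \<forall>f\<in>V. f(j := - f j) \<in> V"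
    by (elim exE conjE) (rule that)
  \<comment> \<open>Single reflections compose to a simultaneous one; \<open>B = A\<close> is the
    point reflection. Values outside \<open>A\<close> are kept, so the function stays
    extensional.\<close>
  have flip: "(\<lambda>j. if j \<in> B then - f j else f j) \<in> V" if "B \<subseteq> A" "f \<in> V" for B f
    using finite_subset[OF that(1) fin] that
  proof (induction B rule: finite_induct)
    case (insert b B)
    have b: "b \<in> A" using insert by auto
    have "(\<lambda>j. if j \<in> B then - f j else f j) \<in> V"
      using insert.prems by (intro insert.IH) auto
    note bspec[OF bspec[OF V(4) b] this]
    moreover have "(\<lambda>j. if j \<in> B then - f j else f j)(b := - (\<lambda>j. if j \<in> B then - f j else f j) b)
        = (\<lambda>j. if j \<in> insert b B then - f j else f j)"
      using insert.hyps by (auto simp: fun_eq_iff)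
    ultimately show ?case by (simp only:)
  qed simp
  have "V \<subseteq> {f. sqrt (\<Sum>j\<in>A. (f j)\<^sup>2) \<le> D / 2} \<inter> space P"
  proof
    fix f assume f: "f \<in> V"
    have "4 * (\<Sum>j\<in>A. (f j)\<^sup>2) = (\<Sum>j\<in>A. (f j - (if j \<in> A then - f j else f j))\<^sup>2)"
      unfolding sum_distrib_left by (rule sum.cong) (auto simp: power2_eq_square algebra_simps)
    also have "\<dots> \<le> D\<^sup>2"
      by (rule bspec[OF bspec[OF V(3) f] flip[OF order_refl f]])
    finally have "4 * (\<Sum>j\<in>A. (f j)\<^sup>2) \<le> D\<^sup>2" .
    then have "sqrt (\<Sum>j\<in>A. (f j)\<^sup>2) \<le> D / 2"
      using D by (intro real_le_lsqrt) (auto simp: power_divide sum_nonneg)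
    then show "f \<in> {f. sqrt (\<Sum>j\<in>A. (f j)\<^sup>2) \<le> D / 2} \<inter> space P"
      using f sets.sets_into_space[OF V(1)] by auto
  qed
  then have "emeasure P V \<le> emeasure P ({f. sqrt (\<Sum>j\<in>A. (f j)\<^sup>2) \<le> D / 2} \<inter> space P)"
    by (rule emeasure_mono) (auto simp: P_def)
  also have "\<dots> = ennreal (unit_ball_vol (real (card A)) * (D / 2) ^ card A)"
    unfolding P_def using fin D by (intro emeasure_cball_aux) auto
  finally show ?thesis using V(2) by (simp add: P_def)
qed

text \<open>Letting \<open>r\<close> decrease to \<open>D\<close> admits \<open>D = 0\<close>, which
  occurs for slices through the apex of a cone and for pieces that are single points.\<close>

lemma isodiametric_PiM:
  fixes A :: "'i set" and U :: "('i \<Rightarrow> real) set"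
  assumes fin: "finite A" and U: "U \<in> sets (Pi\<^sub>M A (\<lambda>_. lborel))" and D: "0 \<le> D"
    and diam: "\<And>f g. f \<in> U \<Longrightarrow> g \<in> U \<Longrightarrow> (\<Sum>j\<in>A. (f j - g j)\<^sup>2) \<le> D\<^sup>2"
  shows "emeasure (Pi\<^sub>M A (\<lambda>_. lborel)) U \<le> ennreal (unit_ball_vol (real (card A)) * (D / 2) ^ card A)"
proof (rule tendsto_lowerbound)
  show "((\<lambda>r. ennreal (unit_ball_vol (real (card A)) * (r / 2) ^ card A)) \<longlongrightarrow>
    ennreal (unit_ball_vol (real (card A)) * (D / 2) ^ card A)) (at_right D)"
    by (intro tendsto_intros) auto
  show "\<forall>\<^sub>F r in at_right D. emeasure (Pi\<^sub>M A (\<lambda>_. lborel)) U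
      \<le> ennreal (unit_ball_vol (real (card A)) * (r / 2) ^ card A)"
    unfolding eventually_at_right_field
  proof (intro exI[of _ "D + 1"] conjI allI impI)
    fix r assume r: "D < r"
    have "D\<^sup>2 \<le> r\<^sup>2" using r D by (intro power_mono) auto
    then show "emeasure (Pi\<^sub>M A (\<lambda>_. lborel)) U
        \<le> ennreal (unit_ball_vol (real (card A)) * (r / 2) ^ card A)"
      using r D by (intro isodiametric_PiM_pos[OF fin U]) (auto intro: order_trans[OF diam])
  qed simp
qed auto

section \<open>The Hausdorff measure of the unit sphere\<close>

subsection \<open>Lower bound\<close>

text \<open>Fubini in the coordinate \<open>e\<close>. The slices are kept as sets of functions on
  \<open>Basis - {e}\<close>, the form to which the isodiametric inequality applies.\<close>

lemma emeasure_slices_PiM: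
  fixes K :: "'a::euclidean_space set"
  assumes e: "e \<in> Basis" and K: "K \<in> sets borel"
  shows "emeasure lborel K = (\<integral>\<^sup>+h. emeasure (Pi\<^sub>M (Basis - {e}) (\<lambda>_. lborel))
     {f \<in> space (Pi\<^sub>M (Basis - {e}) (\<lambda>_. lborel)). (\<Sum>b\<in>Basis. (f(e := h)) b *\<^sub>R b) \<in> K} \<partial>lborel)"
    and "{f \<in> space (Pi\<^sub>M (Basis - {e}) (\<lambda>_. lborel)). (\<Sum>b\<in>Basis. (f(e := h)) b *\<^sub>R b) \<in> K}
      \<in> sets (Pi\<^sub>M (Basis - {e}) (\<lambda>_. lborel))"
proof -
  interpret product_sigma_finite "\<lambda>_::'a. lborel :: real measure" by standard
  define A where "A = Basis - {e}"
  define \<Phi> where "\<Phi> f = (\<Sum>b\<in>Basis. f b *\<^sub>R b)" for f :: "'a \<Rightarrow> real"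
  have A: "insert e A = Basis" "e \<notin> A" "finite A" using e by (auto simp: A_def)
  have \<Phi>: "\<Phi> \<in> measurable (Pi\<^sub>M Basis (\<lambda>_. lborel)) borel"
    unfolding \<Phi>_def by measurable
  have "(\<lambda>f. f(e := h)) \<in> measurable (Pi\<^sub>M A (\<lambda>_. lborel)) (Pi\<^sub>M Basis (\<lambda>_. lborel))" for h
    by (rule measurable_fun_upd[where J = A]) (use A in auto)
  then have upd: "(\<lambda>f. \<Phi> (f(e := h))) \<in> measurable (Pi\<^sub>M A (\<lambda>_. lborel)) borel" for h
    by (rule measurable_compose[OF _ \<Phi>])
  show sl: "{f \<in> space (Pi\<^sub>M (Basis - {e}) (\<lambda>_. lborel)). (\<Sum>b\<in>Basis. (f(e := h)) b *\<^sub>R b) \<in> K}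
      \<in> sets (Pi\<^sub>M (Basis - {e}) (\<lambda>_. lborel))" for h
    using measurable_sets[OF upd K, of h]
    unfolding \<Phi>_def A_def by (simp add: vimage_def Int_def conj_commute)
  have "emeasure lborel K = emeasure (distr (Pi\<^sub>M Basis (\<lambda>_. lborel)) borel \<Phi>) K"
    unfolding \<Phi>_def by (subst lborel_eq) simp
  also have "\<dots> = (\<integral>\<^sup>+x. indicator K x \<partial>distr (Pi\<^sub>M Basis (\<lambda>_. lborel)) borel \<Phi>)"
    using K by simp
  also have "\<dots> = (\<integral>\<^sup>+f. indicator K (\<Phi> f) \<partial>Pi\<^sub>M (insert e A) (\<lambda>_. lborel))"
    unfolding A(1) using K by (intro nn_integral_distr[OF \<Phi>]) auto
  also have "\<dots> = (\<integral>\<^sup>+h. (\<integral>\<^sup>+f. indicator K (\<Phi> (f(e := h))) \<partial>Pi\<^sub>M A (\<lambda>_. lborel)) \<partial>lborel)"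
  proof (rule product_nn_integral_insert_rev[OF A(3,2)])
    show "(\<lambda>f. indicator K (\<Phi> f) :: ennreal) \<in> borel_measurable (Pi\<^sub>M (insert e A) (\<lambda>_. lborel))"
      unfolding A(1) by (rule measurable_compose[OF \<Phi>]) (use K in auto)
  qed
  also have "\<dots> = (\<integral>\<^sup>+h. emeasure (Pi\<^sub>M A (\<lambda>_. lborel)) {f \<in> space (Pi\<^sub>M A (\<lambda>_. lborel)). \<Phi> (f(e := h)) \<in> K} \<partial>lborel)"
  proof (rule nn_integral_cong)
    fix h :: real
    have "(\<integral>\<^sup>+f. indicator K (\<Phi> (f(e := h))) \<partial>Pi\<^sub>M A (\<lambda>_. lborel)) =
      (\<integral>\<^sup>+f. indicator {f \<in> space (Pi\<^sub>M A (\<lambda>_. lborel)). \<Phi> (f(e := h)) \<in> K} f \<partial>Pi\<^sub>M A (\<lambda>_. lborel))"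
      by (rule nn_integral_cong) (auto simp: indicator_def)
    also have "\<dots> = emeasure (Pi\<^sub>M A (\<lambda>_. lborel)) {f \<in> space (Pi\<^sub>M A (\<lambda>_. lborel)). \<Phi> (f(e := h)) \<in> K}"
      using sl[of h] unfolding A_def \<Phi>_def by (rule nn_integral_indicator)
    finally show "(\<integral>\<^sup>+f. indicator K (\<Phi> (f(e := h))) \<partial>Pi\<^sub>M A (\<lambda>_. lborel)) = \<dots>" .
  qed
  finally show "emeasure lborel K = (\<integral>\<^sup>+h. emeasure (Pi\<^sub>M (Basis - {e}) (\<lambda>_. lborel))
     {f \<in> space (Pi\<^sub>M (Basis - {e}) (\<lambda>_. lborel)). (\<Sum>b\<in>Basis. (f(e := h)) b *\<^sub>R b) \<in> K} \<partial>lborel)"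
    by (simp only: A_def \<Phi>_def)
qed

text \<open>The isodiametric inequality bounds the slice at height \<open>h\<close> by a constant
  times \<open>h ^ d\<close> with \<open>d = DIM('a) - 1\<close>, and integrating
  \<open>h ^ d\<close> over the unit interval gives the divisor \<open>DIM('a)\<close>. A diameter
  bound linear in the height is what a cone with apex 0 provides.\<close>

lemma emeasure_le_of_slice_diameter:
  fixes K :: "'a::euclidean_space set"
  assumes e: "e \<in> Basis" and K: "K \<in> sets borel" and c: "0 \<le> c"
    and range: "\<And>x. x \<in> K \<Longrightarrow> 0 \<le> x \<bullet> e \<and> x \<bullet> e \<le> 1"
    and diam: "\<And>x y. x \<in> K \<Longrightarrow> y \<in> K \<Longrightarrow> x \<bullet> e = y \<bullet> e \<Longrightarrow> norm (x - y) \<le> c * (x \<bullet> e)"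
  shows "emeasure lborel K \<le>
    ennreal (unit_ball_vol (real (DIM('a) - 1)) * (c / 2) ^ (DIM('a) - 1) / real (DIM('a)))"
proof -
  define d where "d = DIM('a) - 1"
  have card: "card (Basis - {e} :: 'a set) = d" using e by (simp add: d_def)
  have Sd: "Suc d = DIM('a)" unfolding d_def using DIM_positive[where 'a='a] by simp
  define \<Phi> where "\<Phi> f = (\<Sum>b\<in>Basis. f b *\<^sub>R b)" for f :: "'a \<Rightarrow> real"
  have \<Phi>_inner: "\<Phi> f \<bullet> b = f b" if "b \<in> Basis" for f b
    unfolding \<Phi>_def using that by simp
  define P where "P = (Pi\<^sub>M (Basis - {e}) (\<lambda>_. lborel) :: ('a \<Rightarrow> real) measure)"
  define U where "U h = {f \<in> space P. \<Phi> (f(e := h)) \<in> K}" for h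
  have "emeasure P (U h) \<le> ennreal (unit_ball_vol (real d) * (c / 2) ^ d * h ^ d) * indicator {0..1} h" for h
  proof (cases "U h = {}")
    case False
    then obtain f where "\<Phi> (f(e := h)) \<in> K" by (auto simp: U_def)
    from range[OF this] have h: "0 \<le> h" "h \<le> 1" unfolding \<Phi>_inner[OF e] by auto
    have "emeasure P (U h) \<le> ennreal (unit_ball_vol (real d) * (c * h / 2) ^ d)"
      unfolding P_def card[symmetric]
    proof (rule isodiametric_PiM)
      show "U h \<in> sets (Pi\<^sub>M (Basis - {e}) (\<lambda>_. lborel))"
        unfolding U_def \<Phi>_def P_def by (rule emeasure_slices_PiM(2)[OF e K])
      show "0 \<le> c * h" using c h by simp
    next
      fix f g assume "f \<in> U h" "g \<in> U h"
      then have fg: "\<Phi> (f(e := h)) \<in> K" "\<Phi> (g(e := h)) \<in> K" by (auto simp: U_def)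
      have "norm (\<Phi> (f(e := h)) - \<Phi> (g(e := h))) \<le> c * h"
        using diam[OF fg] by (simp add: \<Phi>_inner[OF e])
      then have "(norm (\<Phi> (f(e := h)) - \<Phi> (g(e := h))))\<^sup>2 \<le> (c * h)\<^sup>2"
        by (rule power_mono) simp
      also have "(norm (\<Phi> (f(e := h)) - \<Phi> (g(e := h))))\<^sup>2 = (\<Sum>b\<in>Basis. ((f(e := h)) b - (g(e := h)) b)\<^sup>2)"
        unfolding power2_norm_eq_inner
        by (subst euclidean_inner) (simp add: inner_diff_left \<Phi>_inner power2_eq_square del: fun_upd_apply)
      also have "\<dots> = (\<Sum>b\<in>Basis - {e}. (f b - g b)\<^sup>2)"
        by (subst sum.remove[OF _ e]) (auto intro: sum.cong)
      finally show "(\<Sum>b\<in>Basis - {e}. (f b - g b)\<^sup>2) \<le> (c * h)\<^sup>2" .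
    qed simp
    then show ?thesis using h by (simp add: power_mult_distrib power_divide field_simps)
  qed simp
  then have "emeasure lborel K \<le>
      (\<integral>\<^sup>+h. ennreal (unit_ball_vol (real d) * (c / 2) ^ d * h ^ d) * indicator {0..1} h \<partial>lborel)"
    unfolding emeasure_slices_PiM(1)[OF e K] U_def P_def \<Phi>_def by (rule nn_integral_mono)
  also have "\<dots> = ennreal (unit_ball_vol (real d) * (c / 2) ^ d * 1 ^ Suc d / Suc d
      - unit_ball_vol (real d) * (c / 2) ^ d * 0 ^ Suc d / Suc d)"
    using c by (intro nn_integral_FTC_Icc) (auto intro!: derivative_eq_intros simp del: power_Suc)
  finally show ?thesis unfolding Sd[symmetric] by simp
qed

section \<open>Cones over small pieces of the sphere\<close>

text \<open>Let \<alpha> and \<beta> be the inner products of \<open>x\<close> and \<open>y\<close>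
  with \<open>e\<close>. Points of the two rays at the common height \<open>h\<close> differ by
  \<open>h / (\<alpha> * \<beta>)\<close> times
  \<open>\<beta> *\<^sub>R x - \<alpha> *\<^sub>R y\<close>, whose squared norm is \<open>(\<alpha>
  - \<beta>)\<^sup>2 + \<alpha> * \<beta> * (norm (x - y))\<^sup>2\<close>. Near \<open>e\<close>
  both inner products are close to 1 and their difference is small compared with
  \<open>D\<close>.\<close>

lemma sphere_gnomonic_bound:
  fixes x y e :: "'a::real_inner"
  assumes n: "norm x = 1" "norm y = 1" "norm e = 1" and \<delta>: "0 < \<delta>" "\<delta> < 1"
    and d: "norm (x - e) \<le> \<delta>" "norm (y - e) \<le> \<delta>" and D: "norm (x - y) \<le> D"
    and st: "0 \<le> s" "0 \<le> t" and eq: "(s *\<^sub>R x) \<bullet> e = (t *\<^sub>R y) \<bullet> e"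
  shows "norm (s *\<^sub>R x - t *\<^sub>R y) \<le> (1 + \<delta>) / (1 - \<delta>)\<^sup>2 * D * ((s *\<^sub>R x) \<bullet> e)"
proof -
  define \<alpha> \<beta> where "\<alpha> = x \<bullet> e" and "\<beta> = y \<bullet> e"
  have xx: "x \<bullet> x = 1" "y \<bullet> y = 1" "e \<bullet> e = 1" using n by (simp_all add: norm_eq_1)
  have a: "\<alpha> = 1 - (norm (x - e))\<^sup>2 / 2" "\<beta> = 1 - (norm (y - e))\<^sup>2 / 2"
    unfolding \<alpha>_def \<beta>_def power2_norm_eq_inner by (simp_all add: algebra_simps inner_commute xx field_simps)
  have sq: "(norm (x - e))\<^sup>2 \<le> \<delta>" "(norm (y - e))\<^sup>2 \<le> \<delta>"
    using d \<delta> by (auto simp: power2_eq_square intro: order_trans[OF mult_mono[OF d(1) d(1)]] order_trans[OF mult_mono[OF d(2) d(2)]] mult_left_le)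
  have ab: "1 - \<delta> \<le> \<alpha>" "1 - \<delta> \<le> \<beta>" "\<alpha> \<le> 1" "\<beta> \<le> 1" using sq \<delta> unfolding a by auto
  have D0: "0 \<le> D" using D norm_ge_zero order_trans by blast
  \<comment> \<open>The inner product of unit vectors is 1 minus half the squared distance, so the
    difference factors. The triangle inequality bounds the first factor by \<open>D\<close>, the
    mean of the two distances is at most \<delta>.\<close>
  have "\<alpha> - \<beta> = (norm (y - e) - norm (x - e)) * ((norm (y - e) + norm (x - e)) / 2)"
    unfolding a by (simp add: power2_eq_square algebra_simps)
  also have "\<bar>\<dots>\<bar> \<le> D * \<delta>"
    unfolding abs_mult
  proof (rule mult_mono)
    show "\<bar>norm (y - e) - norm (x - e)\<bar> \<le> D"
      using norm_triangle_ineq3[of "y - e" "x - e"] D by (simp add: norm_minus_commute)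
  qed (use d D0 \<delta> in auto)
  finally have abd: "\<bar>\<alpha> - \<beta>\<bar> \<le> D * \<delta>" .
  define h where "h = s * \<alpha>"
  have h: "h = t * \<beta>" "0 \<le> h" using eq st ab \<delta> by (auto simp: h_def \<alpha>_def \<beta>_def)
  have s: "s = h / \<alpha>" "t = h / \<beta>" using ab \<delta> h(1) by (simp_all add: h_def[symmetric] nonzero_eq_divide_eq)
  have "(norm (\<beta> *\<^sub>R x - \<alpha> *\<^sub>R y))\<^sup>2 = (\<alpha> - \<beta>)\<^sup>2 + \<alpha> * \<beta> * (norm (x - y))\<^sup>2"
    unfolding power2_norm_eq_inner
    by (simp add: algebra_simps inner_commute xx power2_eq_square)
  also have "\<dots> \<le> (D * \<delta>)\<^sup>2 + 1 * D\<^sup>2"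
  proof (intro add_mono mult_mono)
    show "(\<alpha> - \<beta>)\<^sup>2 \<le> (D * \<delta>)\<^sup>2" using abd by (simp add: abs_le_square_iff[symmetric])
    show "\<alpha> * \<beta> \<le> 1" using ab \<delta> by (intro mult_le_one) auto
    show "(norm (x - y))\<^sup>2 \<le> D\<^sup>2" using D by (intro power_mono) auto
  qed auto
  also have "\<dots> \<le> ((1 + \<delta>) * D)\<^sup>2"
    using \<delta> D0 by (simp add: power2_eq_square algebra_simps)
  finally have 1: "norm (\<beta> *\<^sub>R x - \<alpha> *\<^sub>R y) \<le> (1 + \<delta>) * D"
    by (rule power2_le_imp_le) (use \<delta> D0 in auto)
  have "s *\<^sub>R x - t *\<^sub>R y = (h / (\<alpha> * \<beta>)) *\<^sub>R (\<beta> *\<^sub>R x - \<alpha> *\<^sub>R y)"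
    using ab \<delta> by (simp add: s algebra_simps)
  then have "norm (s *\<^sub>R x - t *\<^sub>R y) = h / (\<alpha> * \<beta>) * norm (\<beta> *\<^sub>R x - \<alpha> *\<^sub>R y)"
    using h st ab \<delta> by (simp add: abs_mult)
  also have "\<dots> \<le> h / (1 - \<delta>)\<^sup>2 * ((1 + \<delta>) * D)"
  proof (intro mult_mono 1 divide_left_mono)
    show "(1 - \<delta>)\<^sup>2 \<le> \<alpha> * \<beta>" unfolding power2_eq_square using ab \<delta> by (intro mult_mono) auto
  qed (use h ab \<delta> in auto)
  finally show ?thesis by (simp add: h_def \<alpha>_def mult_ac)
qed

text \<open>Fubini turns the volume of \<open>T -` S\<close> times that of a ball into the volume of \<open>S\<close> times that of
  the same ball, because the ball is invariant under \<open>T\<close>.\<close>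

lemma emeasure_lborel_orthogonal_vimage:
  fixes T :: "'a::euclidean_space \<Rightarrow> 'a"
  assumes T: "orthogonal_transformation T" and S: "S \<in> sets borel"
  shows "emeasure lborel (T -` S) = emeasure lborel S"
proof -
  let ?B = "ball (0::'a) 1"
  have lin: "linear T" and nT: "\<And>x. norm (T x) = norm x"
    using T by (auto simp: orthogonal_transformation)
  have Tm [measurable]: "T \<in> borel_measurable borel"
    using lin by (simp add: borel_measurable_continuous_onI linear_continuous_on linear_linear)
  have mS [measurable]: "(indicator S :: 'a \<Rightarrow> ennreal) \<in> borel_measurable borel"
    and mB [measurable]: "(indicator ?B :: 'a \<Rightarrow> ennreal) \<in> borel_measurable borel"
    by (rule borel_measurable_indicator, rule S) (rule borel_measurable_indicator, simp)
  have T1: "(\<lambda>x. T (fst x) + snd x) \<in> borel_measurable (lborel \<Otimes>\<^sub>M lborel)"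
      "(\<lambda>x. fst x - T (snd x)) \<in> borel_measurable (lborel \<Otimes>\<^sub>M lborel)"
    by (intro borel_measurable_add borel_measurable_diff measurable_compose[OF _ Tm]; simp)+
  have [measurable]: "(\<lambda>x. indicator S (T x + y) :: ennreal) \<in> borel_measurable borel"
    "(\<lambda>x. indicator S (T x) :: ennreal) \<in> borel_measurable borel"
    "(\<lambda>x. indicator ?B (y - T x) :: ennreal) \<in> borel_measurable borel"
    "(\<lambda>x. indicator ?B (x - T y) * indicator S x :: ennreal) \<in> borel_measurable borel" for y
    by (intro borel_measurable_times_ennreal borel_measurable_add borel_measurable_diff
        measurable_compose[OF _ mS] measurable_compose[OF _ mB]; simp)+
  have surj: "\<exists>z. T z = y" for y using orthogonal_transformation_surj[OF T] by (metis surjD)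
  have transl: "(\<integral>\<^sup>+x. f (x + c) \<partial>lborel) = (\<integral>\<^sup>+x. f x \<partial>lborel)"
    if [measurable]: "f \<in> borel_measurable borel" for f :: "'a \<Rightarrow> ennreal" and c
    by (subst (2) lborel_distr_plus[of c, symmetric]) (simp add: nn_integral_distr add.commute)
  have B: "0 < emeasure lborel ?B" "emeasure lborel ?B < \<infinity>"
    by (simp_all add: emeasure_ball zero_less_iff_neq_zero[symmetric])
  have pre: "T -` S \<in> sets borel" using measurable_sets[OF Tm S] by simp
  have "emeasure lborel (T -` S) * emeasure lborel ?B
      = (\<integral>\<^sup>+y. indicator ?B y * (\<integral>\<^sup>+x. indicator S (T x) \<partial>lborel) \<partial>lborel)"
  proof -
    have "(\<integral>\<^sup>+x. indicator S (T x) \<partial>lborel) = (\<integral>\<^sup>+x. indicator (T -` S) x \<partial>lborel)"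
      by (rule nn_integral_cong) (simp add: indicator_def)
    moreover have "\<dots> = emeasure lborel (T -` S)" using pre by simp
    moreover have "(\<integral>\<^sup>+y. indicator ?B y * emeasure lborel (T -` S) \<partial>lborel)
        = emeasure lborel ?B * emeasure lborel (T -` S)"
      by (subst nn_integral_multc) (auto intro!: borel_measurable_indicator)
    ultimately show ?thesis by (simp only: mult.commute)
  qed
  also have "\<dots> = (\<integral>\<^sup>+y. (\<integral>\<^sup>+x. indicator ?B y * indicator S (T x + y) \<partial>lborel) \<partial>lborel)"
  proof (rule nn_integral_cong)
    fix y
    obtain z where z: "T z = y" using surj by blast
    have "(\<integral>\<^sup>+x. indicator S (T x + y) \<partial>lborel) = (\<integral>\<^sup>+x. indicator S (T (x + z)) \<partial>lborel)"
      using lin z by (simp add: linear_add)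
    also have "\<dots> = (\<integral>\<^sup>+x. indicator S (T x) \<partial>lborel)"
      by (rule transl[where f = "\<lambda>x. indicator S (T x)"]) measurable
    finally show "indicator ?B y * (\<integral>\<^sup>+x. indicator S (T x) \<partial>lborel)
        = (\<integral>\<^sup>+x. indicator ?B y * indicator S (T x + y) \<partial>lborel)"
      by (simp add: nn_integral_cmult)
  qed
  also have "\<dots> = (\<integral>\<^sup>+x. (\<integral>\<^sup>+y. indicator ?B y * indicator S (T x + y) \<partial>lborel) \<partial>lborel)"
    by (rule lborel_pair.Fubini', unfold case_prod_unfold, intro borel_measurable_times_ennreal
        measurable_compose[OF T1(1) mS] measurable_compose[OF measurable_snd]) simp
  also have "\<dots> = (\<integral>\<^sup>+x. (\<integral>\<^sup>+y. indicator ?B (y - T x) * indicator S y \<partial>lborel) \<partial>lborel)"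
  proof (rule nn_integral_cong)
    fix x
    show "(\<integral>\<^sup>+y. indicator ?B y * indicator S (T x + y) \<partial>lborel)
        = (\<integral>\<^sup>+y. indicator ?B (y - T x) * indicator S y \<partial>lborel)"
      using transl[of "\<lambda>y. indicator ?B (y - T x) * indicator S y" "T x"] by (simp add: add.commute)
  qed
  also have "\<dots> = (\<integral>\<^sup>+y. (\<integral>\<^sup>+x. indicator ?B (y - T x) * indicator S y \<partial>lborel) \<partial>lborel)"
    by (rule lborel_pair.Fubini', unfold case_prod_unfold, intro borel_measurable_times_ennreal
        measurable_compose[OF T1(2) mB] measurable_compose[OF measurable_fst]) simp
  \<comment> \<open>Since \<open>T\<close> is onto and preserves distances, \<open>T x\<close> is
    within 1 of \<open>y = T z\<close> exactly when \<open>x\<close> is within 1 of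
    \<open>z\<close>; the inner integral is the volume of a unit ball for every
    \<open>y\<close>.\<close>
  also have "\<dots> = (\<integral>\<^sup>+y. emeasure lborel ?B * indicator S y \<partial>lborel)"
  proof (rule nn_integral_cong)
    fix y
    obtain z where z: "T z = y" using surj by blast
    have "indicator ?B (y - T x) = (indicator (ball z 1) x :: ennreal)" for x
      using nT[of "z - x"] lin z by (simp add: indicator_def linear_diff dist_norm norm_minus_commute)
    then have "(\<integral>\<^sup>+x. indicator ?B (y - T x) \<partial>lborel) = emeasure lborel (ball z 1)" by simp
    then show "(\<integral>\<^sup>+x. indicator ?B (y - T x) * indicator S y \<partial>lborel) = emeasure lborel ?B * indicator S y"
      by (simp add: nn_integral_multc emeasure_ball)
  qed
  also have "\<dots> = emeasure lborel S * emeasure lborel ?B"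
    by (subst nn_integral_cmult) (use S in \<open>auto simp: mult.commute\<close>)
  finally show ?thesis
    using B by (auto simp: mult.commute[of _ "emeasure lborel ?B"] ennreal_mult_cancel_left)
qed

definition cone_over :: "'a::real_vector set \<Rightarrow> 'a set" where
  "cone_over C = (\<lambda>(t, x). t *\<^sub>R x) ` ({0..1} \<times> C)"

lemma compact_cone_over:
  fixes C :: "'a::real_normed_vector set"
  assumes "compact C"
  shows "compact (cone_over C)"
  unfolding cone_over_def
  by (intro compact_continuous_image compact_Times assms) (auto simp: case_prod_unfold intro!: continuous_intros)

text \<open>A rotation takes a basis vector \<open>e\<close> to a chosen point \<open>p\<close> of
  \<open>C\<close>, so that slices orthogonal to \<open>p\<close> become coordinate slices. By
  \<open>D \<le> \<delta>\<close> all of \<open>C\<close> is within \<delta> of \<open>p\<close>,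
  and \<open>sphere_gnomonic_bound\<close> gives slice diameters linear in the height.\<close>

lemma emeasure_cone_over_le:
  fixes C :: "(real ^ 'n) set"
  assumes C: "compact C" "C \<subseteq> sphere 0 1" "C \<noteq> {}" and \<delta>: "0 < \<delta>" "\<delta> < 1"
    and D: "0 \<le> D" "D \<le> \<delta>" "\<And>x y. x \<in> C \<Longrightarrow> y \<in> C \<Longrightarrow> dist x y \<le> D"
  shows "emeasure lborel (cone_over C) \<le>
    ennreal (unit_ball_vol (real (CARD('n) - 1)) * ((1 + \<delta>) / (1 - \<delta>)\<^sup>2 * D / 2) ^ (CARD('n) - 1) / CARD('n))"
proof -
  obtain p where p: "p \<in> C" using C by blast
  obtain e :: "real ^ 'n" where e: "e \<in> Basis" using nonempty_Basis by blast
  have n: "norm x = 1" if "x \<in> C" for x using C that by auto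
  obtain T where T: "orthogonal_transformation T" "T e = p"
    using orthogonal_transformation_exists[of e p] n[OF p] norm_Basis[OF e] by auto
  have lin: "linear T" and nT: "norm (T x) = norm x" for x
    using T by (auto simp: orthogonal_transformation)
  have inn: "x \<bullet> e = T x \<bullet> p" for x
    using T by (auto simp: orthogonal_transformation_def)
  define K where "K = T -` cone_over C"
  have meas: "cone_over C \<in> sets borel"
    using compact_cone_over[OF C(1)] by (simp add: borel_compact)
  have K: "K \<in> sets borel"
  proof -
    have "T \<in> borel_measurable borel"
      using lin by (simp add: borel_measurable_continuous_onI linear_continuous_on linear_linear)
    from measurable_sets[OF this meas] show ?thesis by (simp add: K_def)
  qed
  have cone: "\<exists>t u. 0 \<le> t \<and> t \<le> 1 \<and> u \<in> C \<and> T x = t *\<^sub>R u" if "x \<in> K" for x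
    using that by (force simp: K_def cone_over_def)
  have near: "norm (u - p) \<le> \<delta>" if "u \<in> C" for u
    using D(2) D(3)[OF that p] by (simp add: dist_norm)
  have "emeasure lborel (cone_over C) = emeasure lborel K"
    unfolding K_def by (rule emeasure_lborel_orthogonal_vimage[OF T(1) meas, symmetric])
  also have "\<dots> \<le> ennreal (unit_ball_vol (real (DIM(real ^ 'n) - 1)) *
      ((1 + \<delta>) / (1 - \<delta>)\<^sup>2 * D / 2) ^ (DIM(real ^ 'n) - 1) / real (DIM(real ^ 'n)))"
  proof (rule emeasure_le_of_slice_diameter[OF e K])
    show "0 \<le> (1 + \<delta>) / (1 - \<delta>)\<^sup>2 * D" using \<delta> D by simp
  next
    fix x assume "x \<in> K"
    then obtain t u where tu: "0 \<le> t" "t \<le> 1" "u \<in> C" "T x = t *\<^sub>R u" using cone by blast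
    have "(norm (u - p))\<^sup>2 = 2 - 2 * (u \<bullet> p)"
      using n[OF tu(3)] n[OF p] unfolding power2_norm_eq_inner
      by (simp add: norm_eq_1 algebra_simps inner_commute)
    moreover have "(norm (u - p))\<^sup>2 \<le> 1\<^sup>2"
      using near[OF tu(3)] \<delta> by (intro power_mono) auto
    ultimately have "0 \<le> u \<bullet> p" by simp
    moreover have "u \<bullet> p \<le> 1"
      using norm_cauchy_schwarz[of u p] n[OF tu(3)] n[OF p] by simp
    ultimately show "0 \<le> x \<bullet> e \<and> x \<bullet> e \<le> 1"
      unfolding inn tu(4) using tu(1,2) by (simp add: mult_le_one)
  next
    fix x y assume xy: "x \<in> K" "y \<in> K" "x \<bullet> e = y \<bullet> e"
    then obtain s t u v where st: "0 \<le> s" "0 \<le> t" "u \<in> C" "v \<in> C" "T x = s *\<^sub>R u" "T y = t *\<^sub>R v"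
      using cone by metis
    have "norm (x - y) = norm (s *\<^sub>R u - t *\<^sub>R v)"
      using nT[of "x - y"] lin st by (simp add: linear_diff)
    also have "\<dots> \<le> (1 + \<delta>) / (1 - \<delta>)\<^sup>2 * D * ((s *\<^sub>R u) \<bullet> p)"
    proof (rule sphere_gnomonic_bound)
      show "(s *\<^sub>R u) \<bullet> p = (t *\<^sub>R v) \<bullet> p" using xy(3) unfolding inn st(5,6) .
      show "norm (u - v) \<le> D" using D(3)[OF st(3,4)] by (simp add: dist_norm)
    qed (use st n p near \<delta> in auto)
    finally show "norm (x - y) \<le> (1 + \<delta>) / (1 - \<delta>)\<^sup>2 * D * (x \<bullet> e)"
      unfolding inn st(5) .
  qed
  finally show ?thesis by simp
qed

text \<open>The cones over the pieces of a cover fill the unit ball, and the volume of each is at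
  most \<open>q ^ d / CARD('n)\<close> times the weight of its piece, where \<open>q\<close> is the
  distortion factor of \<open>sphere_gnomonic_bound\<close>.\<close>

lemma hausdorff_content_sphere_ge:
  assumes \<delta>: "0 < \<delta>" "\<delta> < 1"
  shows "ennreal (unit_ball_vol (real CARD('n)) * CARD('n) / ((1 + \<delta>) / (1 - \<delta>)\<^sup>2) ^ (CARD('n) - 1))
    \<le> hausdorff_content (CARD('n) - 1) \<delta> (sphere (0 :: real ^ 'n) 1)"
  unfolding hausdorff_content_def
proof (rule INF_greatest)
  define q where "q = (1 + \<delta>) / (1 - \<delta>)\<^sup>2"
  define d where "d = CARD('n) - 1"
  have q: "0 < q" using \<delta> by (simp add: q_def)
  fix U :: "nat \<Rightarrow> (real ^ 'n) set"
  assume "U \<in> {U. sphere 0 1 \<subseteq> (\<Union>i. U i) \<and> (\<forall>i. bounded (U i) \<and> diameter (U i) \<le> \<delta>)}"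
  then have U: "sphere 0 1 \<subseteq> (\<Union>i. U i)" "\<And>i. bounded (U i)" "\<And>i. diameter (U i) \<le> \<delta>" by auto
  \<comment> \<open>The closure makes the pieces compact, hence the cones Borel, and has the same
    diameter as \<open>U i\<close>.\<close>
  define C where "C i = closure (U i) \<inter> sphere 0 1" for i
  have comp: "compact (C i)" for i
    unfolding C_def using U(2) by (intro compact_Int) auto
  then have meas: "cone_over (C i) \<in> sets lborel" for i
    using compact_cone_over borel_compact by auto
  have le: "emeasure lborel (cone_over (C i)) \<le> ennreal (q ^ d / CARD('n)) * hausdorff_weight d (U i)" for i
  proof (cases "C i = {}")
    case True
    then show ?thesis by (simp add: cone_over_def)
  next
    case False
    then have ne: "U i \<noteq> {}" by (auto simp: C_def)
    have "emeasure lborel (cone_over (C i)) \<le>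
      ennreal (unit_ball_vol (real (CARD('n) - 1)) * ((1 + \<delta>) / (1 - \<delta>)\<^sup>2 * diameter (U i) / 2) ^ (CARD('n) - 1) / CARD('n))"
    proof (rule emeasure_cone_over_le[OF comp _ False \<delta>])
      fix x y assume "x \<in> C i" "y \<in> C i"
      then show "dist x y \<le> diameter (U i)"
        using diameter_bounded_bound[of "closure (U i)" x y] U(2)[of i]
        by (simp add: C_def diameter_closure bounded_closure)
    qed (use U in \<open>auto simp: C_def intro: diameter_ge_0\<close>)
    also have "\<dots> = ennreal (q ^ d / CARD('n)) * hausdorff_weight d (U i)"
      using ne q diameter_ge_0[OF U(2)[of i]]
      by (simp add: hausdorff_weight_def q_def[symmetric] d_def ennreal_mult[symmetric] power_mult_distrib power_divide mult_ac)
    finally show ?thesis .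
  qed
  have cov: "cball (0 :: real ^ 'n) 1 \<subseteq> (\<Union>i. cone_over (C i))"
  proof
    fix x :: "real ^ 'n" assume x: "x \<in> cball 0 1"
    obtain e :: "real ^ 'n" where e: "e \<in> Basis" using nonempty_Basis by blast
    \<comment> \<open>The direction of \<open>x\<close>; at the origin any unit vector serves,
      because every nonempty cone contains the apex.\<close>
    define u where "u = (if x = 0 then e else x /\<^sub>R norm x)"
    have u: "u \<in> sphere 0 1" "x = norm x *\<^sub>R u" using e by (auto simp: u_def)
    then obtain i where "u \<in> U i" using U(1) by blast
    then have "u \<in> C i" using u closure_subset by (auto simp: C_def)
    then have "x \<in> cone_over (C i)"
      unfolding cone_over_def using x u(2) by (intro image_eqI[of _ _ "(norm x, u)"]) auto
    then show "x \<in> (\<Union>i. cone_over (C i))" by blast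
  qed
  have "ennreal (unit_ball_vol (real CARD('n))) = emeasure lborel (cball (0 :: real ^ 'n) 1)"
    by (simp add: emeasure_cball)
  also have "\<dots> \<le> emeasure lborel (\<Union>i. cone_over (C i))"
    using cov meas by (intro emeasure_mono) auto
  also have "\<dots> \<le> (\<Sum>i. emeasure lborel (cone_over (C i)))"
    using meas by (intro emeasure_subadditive_countably) auto
  also have "\<dots> \<le> (\<Sum>i. ennreal (q ^ d / CARD('n)) * hausdorff_weight d (U i))"
    using le by (intro suminf_le) auto
  also have "\<dots> = ennreal (q ^ d / CARD('n)) * (\<Sum>i. hausdorff_weight d (U i))"
    by simp
  finally have *: "ennreal (unit_ball_vol (real CARD('n)))
      \<le> ennreal (q ^ d / CARD('n)) * (\<Sum>i. hausdorff_weight d (U i))" .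
  have "ennreal (unit_ball_vol (real CARD('n)) * CARD('n) / q ^ d)
      = ennreal (CARD('n) / q ^ d) * ennreal (unit_ball_vol (real CARD('n)))"
    using q by (simp add: ennreal_mult[symmetric] mult_ac)
  also have "\<dots> \<le> ennreal (CARD('n) / q ^ d) * (ennreal (q ^ d / CARD('n)) * (\<Sum>i. hausdorff_weight d (U i)))"
    by (intro mult_left_mono *) simp
  also have "\<dots> = (\<Sum>i. hausdorff_weight d (U i))"
    using q by (simp add: mult.assoc[symmetric] ennreal_mult[symmetric])
  finally show "ennreal (unit_ball_vol (real CARD('n)) * CARD('n) / ((1 + \<delta>) / (1 - \<delta>)\<^sup>2) ^ (CARD('n) - 1))
      \<le> (\<Sum>i. hausdorff_weight (CARD('n) - 1) (U i))"
    by (simp add: q_def d_def)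
qed

lemma hausdorff_measure_sphere_ge:
  "ennreal (CARD('n) * unit_ball_vol (real CARD('n))) \<le> hausdorff_measure (CARD('n) - 1) (sphere (0 :: real ^ 'n) 1)"
proof (rule tendsto_upperbound)
  have "((\<lambda>\<delta>::real. unit_ball_vol (real CARD('n)) * CARD('n) / ((1 + \<delta>) / (1 - \<delta>)\<^sup>2) ^ (CARD('n) - 1)) \<longlongrightarrow>
    unit_ball_vol (real CARD('n)) * CARD('n) / ((1 + 0) / (1 - 0)\<^sup>2) ^ (CARD('n) - 1)) (at_right 0)"
    by (intro tendsto_intros) auto
  then show "((\<lambda>\<delta>::real. ennreal (unit_ball_vol (real CARD('n)) * CARD('n) / ((1 + \<delta>) / (1 - \<delta>)\<^sup>2) ^ (CARD('n) - 1))) \<longlongrightarrow>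
    ennreal (CARD('n) * unit_ball_vol (real CARD('n)))) (at_right 0)"
    by (intro tendsto_ennrealI) (simp add: mult.commute)
  show "\<forall>\<^sub>F \<delta>::real in at_right 0. ennreal (unit_ball_vol (real CARD('n)) * CARD('n) / ((1 + \<delta>) / (1 - \<delta>)\<^sup>2) ^ (CARD('n) - 1))
    \<le> hausdorff_measure (CARD('n) - 1) (sphere (0 :: real ^ 'n) 1)"
    unfolding eventually_at_right_field
  proof (intro exI[of _ 1] conjI allI impI)
    fix \<delta> :: real assume \<delta>: "0 < \<delta>" "\<delta> < 1"
    show "ennreal (unit_ball_vol (real CARD('n)) * CARD('n) / ((1 + \<delta>) / (1 - \<delta>)\<^sup>2) ^ (CARD('n) - 1))
      \<le> hausdorff_measure (CARD('n) - 1) (sphere (0 :: real ^ 'n) 1)"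
      unfolding hausdorff_measure_def
      using \<delta> by (intro SUP_upper2[where i = \<delta>] hausdorff_content_sphere_ge) auto
  qed simp
qed auto

subsection \<open>Upper bound\<close>

lemma suminf_interleave_le:
  fixes f g :: "nat \<Rightarrow> ennreal"
  shows "(\<Sum>n. if even n then f (n div 2) else g (n div 2)) \<le> (\<Sum>n. f n) + (\<Sum>n. g n)"
proof (rule suminf_le_const[OF summableI])
  let ?h = "\<lambda>n. if even n then f (n div 2) else g (n div 2)"
  fix N
  have "(\<Sum>n<N. ?h n) \<le> (\<Sum>n<2 * N. ?h n)" by (rule sum_mono2) auto
  also have "\<dots> = (\<Sum>n<N. f n) + (\<Sum>n<N. g n)"
    by (induction N) (auto simp: algebra_simps)
  also have "\<dots> \<le> (\<Sum>n. f n) + (\<Sum>n. g n)"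
    by (intro add_mono sum_le_suminf) auto
  finally show "(\<Sum>n<N. ?h n) \<le> (\<Sum>n. f n) + (\<Sum>n. g n)" .
qed

text \<open>The content ranges over single sequences of sets, so the two families are interleaved,
  \<open>V\<close> at even and \<open>W\<close> at odd indices.\<close>

lemma hausdorff_content_le_two:
  fixes V W :: "nat \<Rightarrow> 'a::metric_space set"
  assumes "A \<subseteq> (\<Union>n. V n) \<union> (\<Union>n. W n)"
    and "\<And>n. bounded (V n) \<and> diameter (V n) \<le> \<delta>" and "\<And>n. bounded (W n) \<and> diameter (W n) \<le> \<delta>"
  shows "hausdorff_content d \<delta> A \<le> (\<Sum>n. hausdorff_weight d (V n)) + (\<Sum>n. hausdorff_weight d (W n))"
proof -
  define U where "U n = (if even n then V (n div 2) else W (n div 2))" for n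
  have VU: "V n = U (2 * n)" and WU: "W n = U (2 * n + 1)" for n by (auto simp: U_def)
  have "(\<Union>n. V n) \<union> (\<Union>n. W n) \<subseteq> (\<Union>n. U n)" unfolding VU WU by auto
  with assms(1) have "A \<subseteq> (\<Union>n. U n)" by (rule subset_trans)
  then have "hausdorff_content d \<delta> A \<le> (\<Sum>n. hausdorff_weight d (U n))"
    unfolding hausdorff_content_def using assms(2,3) by (intro INF_lower) (auto simp: U_def)
  also have "(\<lambda>n. hausdorff_weight d (U n)) =
      (\<lambda>n. if even n then hausdorff_weight d (V (n div 2)) else hausdorff_weight d (W (n div 2)))"
    by (auto simp: U_def)
  also note suminf_interleave_le
  finally show ?thesis .
qed

lemma hausdorff_content_antimono:
  "\<delta> \<le> \<delta>' \<Longrightarrow> hausdorff_content d \<delta>' A \<le> hausdorff_content d \<delta> A"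
  unfolding hausdorff_content_def by (rule INF_superset_mono) (auto intro: order_trans)

lemma hausdorff_weight_le:
  fixes U :: "'a::real_normed_vector set"
  assumes "0 \<le> D" "\<And>x y. x \<in> U \<Longrightarrow> y \<in> U \<Longrightarrow> dist x y \<le> 2 * D"
  shows "hausdorff_weight d U \<le> ennreal (unit_ball_vol (real d) * D ^ d)"
proof (cases "U = {}")
  case False
  then obtain u where "u \<in> U" by blast
  then have "bounded U" unfolding bounded_def using assms(2) by (intro exI[of _ u] exI[of _ "2 * D"]) simp
  moreover have "diameter U \<le> 2 * D"
    using assms False by (intro diameter_le) (auto simp: dist_norm)
  ultimately show ?thesis
    using False by (auto simp: hausdorff_weight_def intro!: ennreal_leI mult_left_mono power_mono diameter_ge_0)
qed (simp add: hausdorff_weight_def)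

text \<open>Put \<open>a = norm c\<close>. The sphere of radius \<open>t\<close> about 0 and that of
  radius \<open>r\<close> about \<open>c\<close> meet in a hyperplane at distance \<open>k\<close>
  from 0, and the cap lies within \<open>sqrt (t\<^sup>2 - k\<^sup>2)\<close> of the point
  \<open>p\<close> where the axis crosses it. The bound is phrased with
  \<open>r\<^sup>2 - (t - a)\<^sup>2\<close>, the squared radius of a flat slice of the ball, so
  that integration over \<open>t\<close> can recover the volume of the ball.\<close>

lemma sphere_cap_dist_le:
  fixes c y z :: "'a::real_inner"
  assumes c: "1 / 2 \<le> norm c" and r: "r \<le> 1 / 2" "0 \<le> r"
    and y: "norm y = t" "dist c y \<le> r" and z: "norm z = t" "dist c z \<le> r"
  shows "dist y z \<le> 2 * ((1 + r) * sqrt (r\<^sup>2 - (t - norm c)\<^sup>2))"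
proof -
  define a where "a = norm c"
  define k where "k = (t\<^sup>2 + a\<^sup>2 - r\<^sup>2) / (2 * a)"
  have a: "1 / 2 \<le> a" "0 < a" using c by (auto simp: a_def)
  have t: "0 \<le> t" using y by auto
  have ta: "\<bar>t - a\<bar> \<le> r"
    using norm_triangle_ineq3[of c y] y by (simp add: a_def dist_norm abs_minus_commute)
  have "r\<^sup>2 \<le> a\<^sup>2" using r a by (intro power_mono) auto
  then have "0 \<le> t\<^sup>2 + a\<^sup>2 - r\<^sup>2" using zero_le_power2[of t] by linarith
  \<comment> \<open>The hyperplane is on the side of \<open>c\<close> because
    \<open>r \<le> 1 / 2 \<le> a\<close>; the sign matters when an inequality is multiplied by
    \<open>k\<close> below.\<close>
  then have k0: "0 \<le> k" unfolding k_def using a by simp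
  define p where "p = (k / a) *\<^sub>R c"
  have cc: "c \<bullet> c = a\<^sup>2" by (simp add: a_def power2_norm_eq_inner)
  have near: "norm (w - p) \<le> sqrt (t\<^sup>2 - k\<^sup>2)" if w: "norm w = t" "dist c w \<le> r" for w
  proof -
    have ww: "w \<bullet> w = t\<^sup>2" using w by (simp add: power2_norm_eq_inner[symmetric])
    have "(norm (c - w))\<^sup>2 \<le> r\<^sup>2" using w r by (intro power_mono) (auto simp: dist_norm)
    then have "a\<^sup>2 + t\<^sup>2 - 2 * (c \<bullet> w) \<le> r\<^sup>2"
      unfolding power2_norm_eq_inner by (simp add: algebra_simps inner_commute ww cc)
    then have "k \<le> (2 * (c \<bullet> w)) / (2 * a)" unfolding k_def using a by (intro divide_right_mono) auto
    then have "k \<le> (c \<bullet> w) / a" by simp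
    then have "k * k \<le> k * ((c \<bullet> w) / a)" using k0 by (rule mult_left_mono)
    moreover have "(norm (w - p))\<^sup>2 = t\<^sup>2 - 2 * (k * ((c \<bullet> w) / a)) + k\<^sup>2"
      unfolding power2_norm_eq_inner p_def using a
      by (simp add: algebra_simps inner_commute ww cc power2_eq_square)
    ultimately have "(norm (w - p))\<^sup>2 \<le> t\<^sup>2 - k\<^sup>2" by (simp add: power2_eq_square)
    then show ?thesis by (rule real_le_rsqrt)
  qed
  \<comment> \<open>A difference of squares, factored. Once \<open>- r\<^sup>2\<close> is dropped,
    the factor \<open>(t + a) / (2 * a)\<close> is at most \<open>1 + r / (2 * a)\<close>, hence at
    most \<open>1 + r\<close>, by \<open>t \<le> a + r\<close> and
    \<open>1 \<le> 2 * a\<close>.\<close>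
  have "t\<^sup>2 - k\<^sup>2 = (r\<^sup>2 - (t - a)\<^sup>2) * ((t + a)\<^sup>2 - r\<^sup>2) / (2 * a)\<^sup>2"
  proof -
    have "t\<^sup>2 - k\<^sup>2 = ((2 * a * t)\<^sup>2 - (t\<^sup>2 + a\<^sup>2 - r\<^sup>2)\<^sup>2) / (2 * a)\<^sup>2"
    proof -
      have "t\<^sup>2 = (2 * a * t)\<^sup>2 / (2 * a)\<^sup>2" using a by (simp add: power_mult_distrib)
      moreover have "k\<^sup>2 = (t\<^sup>2 + a\<^sup>2 - r\<^sup>2)\<^sup>2 / (2 * a)\<^sup>2" by (simp only: k_def power_divide)
      ultimately show ?thesis by (simp only: diff_divide_distrib)
    qed
    also have "(2 * a * t)\<^sup>2 - (t\<^sup>2 + a\<^sup>2 - r\<^sup>2)\<^sup>2 = (r\<^sup>2 - (t - a)\<^sup>2) * ((t + a)\<^sup>2 - r\<^sup>2)"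
      by algebra
    finally show ?thesis .
  qed
  also have "\<dots> \<le> (r\<^sup>2 - (t - a)\<^sup>2) * (t + a)\<^sup>2 / (2 * a)\<^sup>2"
    using abs_le_square_iff[of "t - a" r] ta r by (intro divide_right_mono mult_left_mono) auto
  also have "\<dots> = (r\<^sup>2 - (t - a)\<^sup>2) * ((t + a) / (2 * a))\<^sup>2" by (simp add: power_divide)
  also have "\<dots> \<le> (r\<^sup>2 - (t - a)\<^sup>2) * (1 + r)\<^sup>2"
  proof (intro mult_left_mono power_mono)
    have "r * 1 \<le> r * (2 * a)" using a r by (intro mult_left_mono) auto
    then show "(t + a) / (2 * a) \<le> 1 + r" using ta a by (simp add: field_simps)
  qed (use abs_le_square_iff[of "t - a" r] ta r a t in auto)
  finally have "sqrt (t\<^sup>2 - k\<^sup>2) \<le> sqrt ((r\<^sup>2 - (t - a)\<^sup>2) * (1 + r)\<^sup>2)"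
    by (rule real_sqrt_le_mono)
  also have "\<dots> = (1 + r) * sqrt (r\<^sup>2 - (t - a)\<^sup>2)" using r by (simp add: real_sqrt_mult)
  finally have "sqrt (t\<^sup>2 - k\<^sup>2) \<le> (1 + r) * sqrt (r\<^sup>2 - (t - a)\<^sup>2)" .
  moreover have "dist y z \<le> norm (y - p) + norm (z - p)"
    using norm_triangle_ineq4[of "y - p" "z - p"] by (simp add: dist_norm)
  ultimately show ?thesis using near[OF y] near[OF z] by (simp add: a_def)
qed

text \<open>A ball in dimension \<open>Suc d\<close> integrated slice by slice, centred at height
  \<open>a\<close>. The substitution \<open>t = a + r * x\<close> reduces it to the Beta integral
  that links consecutive values of \<open>unit_ball_vol\<close>.\<close>

lemma nn_integral_ball_slices:
  fixes a r :: real
  assumes "0 \<le> r"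
  shows "(\<integral>\<^sup>+t. ennreal (unit_ball_vol (real d) * sqrt (r\<^sup>2 - (t - a)\<^sup>2) ^ d) * indicator {a - r..a + r} t \<partial>lborel)
    = ennreal (unit_ball_vol (real (Suc d)) * r ^ Suc d)"
proof (cases "r = 0")
  case True
  \<comment> \<open>The integrand is supported on the single point \<open>a\<close>; for
    \<open>d = 0\<close> it is 1 there because \<open>0 ^ 0 = 1\<close>, so the argument is almost
    everywhere.\<close>
  have "(\<integral>\<^sup>+t. ennreal (unit_ball_vol (real d) * sqrt (r\<^sup>2 - (t - a)\<^sup>2) ^ d) * indicator {a - r..a + r} t \<partial>lborel)
    = (\<integral>\<^sup>+t. 0 \<partial>(lborel :: real measure))"
    using AE_lborel_singleton[of a] by (intro nn_integral_cong_AE, eventually_elim) (simp add: True)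
  then show ?thesis by (simp add: True)
next
  case False
  with assms have r: "0 < r" by simp
  have "(\<integral>\<^sup>+t. ennreal (unit_ball_vol (real d) * sqrt (r\<^sup>2 - (t - a)\<^sup>2) ^ d) * indicator {a - r..a + r} t \<partial>lborel)
    = ennreal \<bar>r\<bar> * (\<integral>\<^sup>+x. ennreal (unit_ball_vol (real d) * sqrt (r\<^sup>2 - (a + r * x - a)\<^sup>2) ^ d) * indicator {a - r..a + r} (a + r * x) \<partial>lborel)"
    using r by (intro nn_integral_real_affine) auto
  also have "(\<integral>\<^sup>+x. ennreal (unit_ball_vol (real d) * sqrt (r\<^sup>2 - (a + r * x - a)\<^sup>2) ^ d) * indicator {a - r..a + r} (a + r * x) \<partial>lborel)
    = (\<integral>\<^sup>+x. ennreal (unit_ball_vol (real d) * r ^ d) * ennreal (indicator {-1..1} x * sqrt (1 - x\<^sup>2) ^ d) \<partial>lborel)"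
  proof (rule nn_integral_cong)
    fix x :: real
    have i: "indicator {a - r..a + r} (a + r * x) = (indicator {-1..1} x :: ennreal)"
    proof -
      have "- r \<le> r * x \<longleftrightarrow> - 1 \<le> x" "r * x \<le> r \<longleftrightarrow> x \<le> 1"
        using r mult_le_cancel_left_pos[of r "-1" x] mult_le_cancel_left_pos[of r x 1] by auto
      then show ?thesis by (auto simp: indicator_def)
    qed
    have "r\<^sup>2 - (a + r * x - a)\<^sup>2 = r\<^sup>2 * (1 - x\<^sup>2)" by (simp add: power_mult_distrib algebra_simps)
    then have s: "sqrt (r\<^sup>2 - (a + r * x - a)\<^sup>2) = r * sqrt (1 - x\<^sup>2)" using r by (simp add: real_sqrt_mult)
    show "ennreal (unit_ball_vol (real d) * sqrt (r\<^sup>2 - (a + r * x - a)\<^sup>2) ^ d) * indicator {a - r..a + r} (a + r * x)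
      = ennreal (unit_ball_vol (real d) * r ^ d) * ennreal (indicator {-1..1} x * sqrt (1 - x\<^sup>2) ^ d)"
      unfolding i s using r by (auto simp: indicator_def power_mult_distrib ennreal_mult'[symmetric] mult_ac)
  qed
  also have "\<dots> = ennreal (unit_ball_vol (real d) * r ^ d) * ennreal (Beta (1 / 2) (real d / 2 + 1))"
    by (subst nn_integral_cmult) (simp_all add: emeasure_cball_aux_integral)
  also have "ennreal \<bar>r\<bar> * (ennreal (unit_ball_vol (real d) * r ^ d) * ennreal (Beta (1 / 2) (real d / 2 + 1)))
    = ennreal (unit_ball_vol (real d) * Beta (1 / 2) (real d / 2 + 1) * r ^ Suc d)"
    using r by (simp add: ennreal_mult'[symmetric] mult_ac)
  also have "unit_ball_vol (real d) * Beta (1 / 2) (real d / 2 + 1) = unit_ball_vol (Suc d)"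
    by (auto simp: unit_ball_vol_def Beta_def Gamma_eq_zero_iff field_simps
          Gamma_one_half_real powr_half_sqrt [symmetric] powr_add [symmetric])
  finally show ?thesis .
qed

text \<open>Indices that the enumeration does not use receive radius 0, hence an empty ball. This
  treats finite and infinite families alike and keeps the sequence disjoint.\<close>

lemma disjoint_balls_sequence:
  fixes C :: "('a::metric_space \<times> real) set"
  assumes "countable C" and "pairwise (\<lambda>i j. disjnt (ball (fst i) (snd i)) (ball (fst j) (snd j))) C"
  shows "\<exists>(c :: nat \<Rightarrow> 'a) (r :: nat \<Rightarrow> real). (\<forall>n. r n = 0 \<or> (c n, r n) \<in> C) \<and>
    (\<forall>i\<in>C. \<exists>n. (c n, r n) = i) \<and> disjoint_family (\<lambda>n. ball (c n) (r n))"
proof -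
  define g where "g n = (if n \<in> to_nat_on C ` C then from_nat_into C n else (undefined, 0))" for n
  have g: "g (to_nat_on C i) = i" if "i \<in> C" for i using that assms(1) by (auto simp: g_def)
  have g': "(snd (g n) = 0 \<and> n \<notin> to_nat_on C ` C) \<or> (g n \<in> C \<and> n = to_nat_on C (g n))" for n
    using assms(1) by (auto simp: g_def)
  show ?thesis
  proof (intro exI[of _ "\<lambda>n. fst (g n)"] exI[of _ "\<lambda>n. snd (g n)"] conjI ballI allI)
    show "snd (g n) = 0 \<or> (fst (g n), snd (g n)) \<in> C" for n using g'[of n] by auto
    show "\<exists>n. (fst (g n), snd (g n)) = i" if "i \<in> C" for i using g[OF that] by (intro exI[of _ "to_nat_on C i"]) simp
    show "disjoint_family (\<lambda>n. ball (fst (g n)) (snd (g n)))"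
      unfolding disjoint_family_on_def
    proof (intro ballI impI)
      fix m n :: nat assume "m \<noteq> n"
      show "ball (fst (g m)) (snd (g m)) \<inter> ball (fst (g n)) (snd (g n)) = {}"
      proof (cases "snd (g m) = 0 \<or> snd (g n) = 0")
        case False
        then have "g m \<in> C" "g n \<in> C" "g m \<noteq> g n" using g'[of m] g'[of n] \<open>m \<noteq> n\<close> by metis+
        then show ?thesis using assms(2) by (auto simp: pairwise_def disjnt_def)
      qed auto
    qed
  qed
qed

lemma negligible_open_superset:
  fixes Z :: "'a::euclidean_space set"
  assumes "negligible Z" "0 < e"
  obtains T where "open T" "Z \<subseteq> T" "emeasure lborel T \<le> ennreal e"
proof -
  have Z: "Z \<in> sets lebesgue" "emeasure lebesgue Z = 0"
    using assms(1) by (auto simp: negligible_iff_null_sets)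
  obtain T where T: "open T" "Z \<subseteq> T" "T - Z \<in> lmeasurable" "emeasure lebesgue (T - Z) < ennreal e"
    using sets_lebesgue_outer_open[OF Z(1) assms(2)] by blast
  have "emeasure lborel T = emeasure lebesgue T" using T(1) by simp
  also have "\<dots> \<le> emeasure lebesgue (Z \<union> (T - Z))"
    using T Z by (intro emeasure_mono) (auto simp: fmeasurable_def)
  also have "\<dots> \<le> emeasure lebesgue Z + emeasure lebesgue (T - Z)"
    using T Z by (intro emeasure_subadditive) (auto simp: fmeasurable_def)
  also have "\<dots> \<le> ennreal e" using T(4) Z(2) by simp
  finally show thesis using T by (intro that)
qed

text \<open>For \<open>t\<close> strictly between \<open>1 / 2\<close> and 1, the caps cut from the
  sphere of radius \<open>t\<close> rescale to a cover of the unit sphere. Multiplying by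
  \<open>t ^ d\<close> and integrating over \<open>t\<close> gives the factor on the left and turns
  cap weights into ball volumes: the disjoint balls of the shell produce the first term, the
  enlarged balls over the leftover null set the second.\<close>

lemma hausdorff_content_sphere_le_aux:
  fixes d :: nat and \<delta> e :: real
  assumes \<delta>: "0 < \<delta>" "\<delta> \<le> 1 / 2" and e: "0 < e" and dim: "DIM('a::euclidean_space) = Suc d"
  shows "hausdorff_content d \<delta> (sphere (0 :: 'a) 1) * ennreal ((1 - (1 / 2) ^ Suc d) / Suc d)
    \<le> ennreal ((1 + \<delta>) ^ d * (unit_ball_vol (real (Suc d)) * (1 - (1 / 2) ^ Suc d)))
      + ennreal (2 * unit_ball_vol (real d) * 5 ^ Suc d / unit_ball_vol (real (Suc d)) * e)"
proof -
  define \<omega> where "\<omega> = unit_ball_vol (real (Suc d))"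
  have \<omega>: "0 < \<omega>" by (simp add: \<omega>_def)
  define G where "G = ball (0 :: 'a) 1 - cball 0 (1 / 2)"
  have G: "open G" by (auto simp: G_def)
  have "emeasure lborel G = emeasure lborel (ball (0 :: 'a) 1) - emeasure lborel (cball (0 :: 'a) (1 / 2))"
    unfolding G_def by (intro emeasure_Diff) (auto simp: emeasure_cball)
  also have "emeasure lborel (ball (0 :: 'a) 1) = ennreal \<omega>"
    by (simp only: emeasure_ball[OF zero_le_one] dim \<omega>_def power_one mult_1_right)
  also have "emeasure lborel (cball (0 :: 'a) (1 / 2)) = ennreal (\<omega> * (1 / 2) ^ Suc d)"
    by (subst emeasure_cball, simp) (simp only: dim \<omega>_def)
  also have "ennreal \<omega> - ennreal (\<omega> * (1 / 2) ^ Suc d) = ennreal (\<omega> * (1 - (1 / 2) ^ Suc d))"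
    using \<omega> by (subst ennreal_minus) (auto simp: right_diff_distrib)
  finally have volG: "emeasure lborel G = ennreal (\<omega> * (1 - (1 / 2) ^ Suc d))" .

  \<comment> \<open>A ball of radius at most \<open>\<delta> / 4\<close> has diameter at most
    \<open>\<delta> / 2\<close>, and rescaling by \<open>1 / t < 2\<close> keeps it below
    \<delta>.\<close>
  define K1 where "K1 = {i :: 'a \<times> real. 0 < snd i \<and> snd i \<le> \<delta> / 4 \<and> ball (fst i) (snd i) \<subseteq> G}"
  have fine: "\<exists>i. i \<in> K1 \<and> x \<in> ball (fst i) (snd i) \<and> snd i < h" if "x \<in> G" "0 < h" for x h
  proof -
    obtain \<epsilon> where \<epsilon>: "0 < \<epsilon>" "ball x \<epsilon> \<subseteq> G" using G \<open>x \<in> G\<close> openE by blast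
    define r where "r = Min {\<epsilon>, h / 2, \<delta> / 4}"
    have "0 < r" "r \<le> \<epsilon>" "r < h" "r \<le> \<delta> / 4" using \<epsilon> \<delta> that by (auto simp: r_def)
    then show ?thesis using \<epsilon> subset_ball[of r \<epsilon> x] by (intro exI[of _ "(x, r)"]) (auto simp: K1_def)
  qed
  obtain C where C: "countable C" "C \<subseteq> K1"
      "pairwise (\<lambda>i j. disjnt (ball (fst i) (snd i)) (ball (fst j) (snd j))) C"
      "negligible (G - (\<Union>i\<in>C. ball (fst i) (snd i)))"
    using Vitali_covering_theorem_balls[of G K1 fst snd, OF fine] .
  define Z where "Z = G - (\<Union>i\<in>C. ball (fst i) (snd i))"
  obtain T where T: "open T" "Z \<subseteq> T" "emeasure lborel T \<le> ennreal e"
    using negligible_open_superset[of Z e] C(4) e unfolding Z_def by blast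
  \<comment> \<open>The bound is \<open>\<delta> / 20\<close> because these balls are enlarged five
    times by the covering lemma, which leads back to \<open>\<delta> / 4\<close>.\<close>
  define K2 where "K2 = {i :: 'a \<times> real. 0 < snd i \<and> snd i \<le> \<delta> / 20 \<and> ball (fst i) (snd i) \<subseteq> T}"
  have Z2: "Z \<subseteq> (\<Union>i\<in>K2. ball (fst i) (snd i))"
  proof
    fix x assume "x \<in> Z"
    then obtain \<epsilon> where \<epsilon>: "0 < \<epsilon>" "ball x \<epsilon> \<subseteq> T" using T openE by blast
    define r where "r = min \<epsilon> (\<delta> / 20)"
    have "(x, r) \<in> K2" "x \<in> ball x r" using \<epsilon> \<delta> subset_ball[of r \<epsilon> x] by (auto simp: K2_def r_def)
    then show "x \<in> (\<Union>i\<in>K2. ball (fst i) (snd i))" by force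
  qed
  have rad2: "0 < snd i \<and> snd i \<le> \<delta> / 20" if "i \<in> K2" for i using that by (simp add: K2_def)
  obtain C' where C': "countable C'" "C' \<subseteq> K2"
      "pairwise (\<lambda>i j. disjnt (ball (fst i) (snd i)) (ball (fst j) (snd j))) C'"
      "Z \<subseteq> (\<Union>i\<in>C'. ball (fst i) (5 * snd i))"
    using Vitali_covering_lemma_balls[where S = Z and K = K2 and a = fst and r = snd and B = "\<delta> / 20",
        OF Z2 rad2] .
  obtain c :: "nat \<Rightarrow> 'a" and r :: "nat \<Rightarrow> real" where cr: "\<forall>n. r n = 0 \<or> (c n, r n) \<in> C" "\<forall>i\<in>C. \<exists>n. (c n, r n) = i"
    "disjoint_family (\<lambda>n. ball (c n) (r n))"
    using disjoint_balls_sequence[OF C(1,3)] by (elim exE conjE) (rule that)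
  obtain c' :: "nat \<Rightarrow> 'a" and r' :: "nat \<Rightarrow> real" where cr': "\<forall>n. r' n = 0 \<or> (c' n, r' n) \<in> C'" "\<forall>i\<in>C'. \<exists>n. (c' n, r' n) = i"
    "disjoint_family (\<lambda>n. ball (c' n) (r' n))"
    using disjoint_balls_sequence[OF C'(1,3)] by (elim exE conjE) (rule that)
  have r: "r n = 0 \<or> 0 < r n \<and> r n \<le> \<delta> / 4 \<and> ball (c n) (r n) \<subseteq> G" for n
  proof (cases "r n = 0")
    case False
    with spec[OF cr(1), of n] C(2) have "(c n, r n) \<in> K1" by blast
    then show ?thesis by (simp add: K1_def)
  qed simp
  have r': "r' n = 0 \<or> 0 < r' n \<and> r' n \<le> \<delta> / 20 \<and> ball (c' n) (r' n) \<subseteq> T" for n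
  proof (cases "r' n = 0")
    case False
    with spec[OF cr'(1), of n] C'(2) have "(c' n, r' n) \<in> K2" by blast
    then show ?thesis by (simp add: K2_def)
  qed simp
  have r0: "0 \<le> r n" "0 \<le> r' n" for n using r[of n] r'[of n] by auto

  have sub: "ball (c n) (r n) \<subseteq> G" "ball (c' n) (r' n) \<subseteq> T" for n
    using r[of n] r'[of n] by (cases "r n = 0"; cases "r' n = 0"; simp)+

  \<comment> \<open>Bounds for \<open>t ^ d\<close> times the cap weights. \<open>F\<close> follows
    the true slices of a ball, because its integral must be sharp up to
    \<open>(1 + \<delta>) ^ d\<close>; \<open>F'\<close> uses only the radius of the enlarged ball,
    since the total volume involved is at most \<open>e\<close> up to a constant.\<close>
  define F where "F n t = ennreal ((1 + \<delta>) ^ d) * (ennreal (unit_ball_vol (real d) * sqrt ((r n)\<^sup>2 - (t - norm (c n))\<^sup>2) ^ d)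
      * indicator {norm (c n) - r n..norm (c n) + r n} t)" for n t
  define F' where "F' n t = ennreal (unit_ball_vol (real d) * (5 * r' n) ^ d)
      * indicator {norm (c' n) - 5 * r' n..norm (c' n) + 5 * r' n} t" for n t
  have content: "ennreal (t ^ d) * hausdorff_content d \<delta> (sphere (0 :: 'a) 1) \<le> (\<Sum>n. F n t) + (\<Sum>n. F' n t)"
    if t: "1 / 2 < t" "t < 1" for t
  proof -
    define V where "V n = {x \<in> sphere (0 :: 'a) 1. t *\<^sub>R x \<in> ball (c n) (r n)}" for n
    define W where "W n = {x \<in> sphere (0 :: 'a) 1. t *\<^sub>R x \<in> ball (c' n) (5 * r' n)}" for n
    have scale: "dist x y = dist (t *\<^sub>R x) (t *\<^sub>R y) / t" for x y :: 'a
      using t by (simp add: dist_norm scaleR_diff_right[symmetric])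
    have ball_dist: "dist x y \<le> 2 * (s / t)" if "t *\<^sub>R x \<in> ball p s" "t *\<^sub>R y \<in> ball p s" for x y p :: 'a and s
    proof -
      have "dist (t *\<^sub>R x) (t *\<^sub>R y) \<le> 2 * s"
        using that dist_triangle3[of "t *\<^sub>R x" "t *\<^sub>R y" p] by simp
      then have "dist (t *\<^sub>R x) (t *\<^sub>R y) / t \<le> 2 * s / t" using t by (intro divide_right_mono) auto
      then show ?thesis using scale[of x y] by simp
    qed
    have small: "bounded {x \<in> sphere (0 :: 'a) 1. t *\<^sub>R x \<in> ball p s} \<and>
        diameter {x \<in> sphere (0 :: 'a) 1. t *\<^sub>R x \<in> ball p s} \<le> \<delta>"
      if "0 \<le> s" "s \<le> \<delta> / 4" for p s
    proof
      show "bounded {x \<in> sphere (0 :: 'a) 1. t *\<^sub>R x \<in> ball p s}"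
        by (rule bounded_subset[OF bounded_sphere[of 0 1]]) auto
      have "2 * (s / t) \<le> \<delta>"
      proof -
        have "\<delta> * (1 / 2) \<le> \<delta> * t" using t \<delta> by (intro mult_left_mono) auto
        then have "2 * s \<le> \<delta> * t" using that by linarith
        then show ?thesis using t by (simp add: field_simps)
      qed
      then have le: "dist x y \<le> \<delta>" if "t *\<^sub>R x \<in> ball p s" "t *\<^sub>R y \<in> ball p s" for x y :: 'a
        using ball_dist[OF that] by linarith
      show "diameter {x \<in> sphere (0 :: 'a) 1. t *\<^sub>R x \<in> ball p s} \<le> \<delta>"
      proof (rule diameter_le)
        fix x y assume "x \<in> {x \<in> sphere (0 :: 'a) 1. t *\<^sub>R x \<in> ball p s}"
          "y \<in> {x \<in> sphere (0 :: 'a) 1. t *\<^sub>R x \<in> ball p s}"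
        then show "norm (x - y) \<le> \<delta>" using le[of x y] unfolding dist_norm by blast
      qed (use \<delta> in simp)
    qed
    have cover: "sphere 0 1 \<subseteq> (\<Union>n. V n) \<union> (\<Union>n. W n)"
    proof
      fix x :: 'a assume x: "x \<in> sphere 0 1"
      then have "t *\<^sub>R x \<in> G" using t by (simp add: G_def)
      then have "t *\<^sub>R x \<in> (\<Union>i\<in>C. ball (fst i) (snd i)) \<union> (\<Union>i\<in>C'. ball (fst i) (5 * snd i))"
        using C'(4) unfolding Z_def by blast
      then consider i where "i \<in> C" "t *\<^sub>R x \<in> ball (fst i) (snd i)"
        | i where "i \<in> C'" "t *\<^sub>R x \<in> ball (fst i) (5 * snd i)"
        by blast
      then show "x \<in> (\<Union>n. V n) \<union> (\<Union>n. W n)"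
      proof cases
        case 1
        then obtain n where "(c n, r n) = i" using bspec[OF cr(2)] by blast
        then have "x \<in> V n" using 1 x by (auto simp: V_def)
        then show ?thesis by blast
      next
        case 2
        then obtain n where "(c' n, r' n) = i" using bspec[OF cr'(2)] by blast
        then have "x \<in> W n" using 2 x by (auto simp: W_def)
        then show ?thesis by blast
      qed
    qed
    have V: "ennreal (t ^ d) * hausdorff_weight d (V n) \<le> F n t" for n
    proof (cases "V n = {}")
      case False
      then obtain x where x: "norm x = 1" "dist (c n) (t *\<^sub>R x) < r n" by (auto simp: V_def)
      have rn: "0 < r n" "r n \<le> \<delta> / 4" "ball (c n) (r n) \<subseteq> G"
        using x(2) r[of n] by auto
      \<comment> \<open>The centre lies in the shell, which supplies the lower bound on
        \<open>norm (c n)\<close> that \<open>sphere_cap_dist_le\<close> asks for.\<close>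
      then have "c n \<in> G" by auto
      then have cn: "1 / 2 \<le> norm (c n)" by (simp add: G_def)
      have tc: "\<bar>t - norm (c n)\<bar> \<le> r n"
        using norm_triangle_ineq3[of "c n" "t *\<^sub>R x"] x t by (simp add: dist_norm abs_minus_commute)
      define q where "q = sqrt ((r n)\<^sup>2 - (t - norm (c n))\<^sup>2)"
      have q: "0 \<le> q" using tc by (simp add: q_def abs_le_square_iff[symmetric])
      have "hausdorff_weight d (V n) \<le> ennreal (unit_ball_vol (real d) * ((1 + r n) * q / t) ^ d)"
      proof (rule hausdorff_weight_le)
        show "0 \<le> (1 + r n) * q / t" using q rn t by simp
        fix x y assume xy: "x \<in> V n" "y \<in> V n"
        have "dist (t *\<^sub>R x) (t *\<^sub>R y) \<le> 2 * ((1 + r n) * q)"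
          unfolding q_def using xy rn \<delta> t cn by (intro sphere_cap_dist_le) (auto simp: V_def)
        then have "dist (t *\<^sub>R x) (t *\<^sub>R y) / t \<le> 2 * ((1 + r n) * q) / t"
          using t by (intro divide_right_mono) auto
        then show "dist x y \<le> 2 * ((1 + r n) * q / t)" using scale[of x y] by simp
      qed
      then have "ennreal (t ^ d) * hausdorff_weight d (V n)
          \<le> ennreal (t ^ d) * ennreal (unit_ball_vol (real d) * ((1 + r n) * q / t) ^ d)"
        by (rule mult_left_mono) simp
      also have "\<dots> = ennreal ((1 + r n) ^ d * (unit_ball_vol (real d) * q ^ d))"
        using t by (simp add: ennreal_mult'[symmetric] power_divide power_mult_distrib mult_ac)
      also have "\<dots> \<le> ennreal ((1 + \<delta>) ^ d * (unit_ball_vol (real d) * q ^ d))"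
        using rn \<delta> q by (intro ennreal_leI mult_right_mono power_mono) auto
      also have "\<dots> = F n t"
        using tc q \<delta> by (simp add: F_def q_def[symmetric] ennreal_mult'[symmetric] abs_le_iff)
      finally show ?thesis .
    qed (simp add: hausdorff_weight_def)
    have W: "ennreal (t ^ d) * hausdorff_weight d (W n) \<le> F' n t" for n
    proof (cases "W n = {}")
      case False
      then obtain x where x: "norm x = 1" "dist (c' n) (t *\<^sub>R x) < 5 * r' n" by (auto simp: W_def)
      have tc: "\<bar>t - norm (c' n)\<bar> \<le> 5 * r' n"
        using norm_triangle_ineq3[of "c' n" "t *\<^sub>R x"] x t by (simp add: dist_norm abs_minus_commute)
      have "hausdorff_weight d (W n) \<le> ennreal (unit_ball_vol (real d) * (5 * r' n / t) ^ d)"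
        using r0[of n] t by (intro hausdorff_weight_le ball_dist) (auto simp: W_def)
      then have "ennreal (t ^ d) * hausdorff_weight d (W n)
          \<le> ennreal (t ^ d) * ennreal (unit_ball_vol (real d) * (5 * r' n / t) ^ d)"
        by (rule mult_left_mono) simp
      also have "\<dots> = F' n t"
        using t tc r0[of n] by (simp add: F'_def ennreal_mult'[symmetric] power_divide abs_le_iff)
      finally show ?thesis .
    qed (simp add: hausdorff_weight_def)
    have "hausdorff_content d \<delta> (sphere (0 :: 'a) 1)
        \<le> (\<Sum>n. hausdorff_weight d (V n)) + (\<Sum>n. hausdorff_weight d (W n))"
      using cover
    proof (rule hausdorff_content_le_two)
      show "bounded (V n) \<and> diameter (V n) \<le> \<delta>" for n
        unfolding V_def by (rule small) (use r[of n] \<delta> in auto)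
      show "bounded (W n) \<and> diameter (W n) \<le> \<delta>" for n
        unfolding W_def by (rule small) (use r'[of n] \<delta> in auto)
    qed
    then have "ennreal (t ^ d) * hausdorff_content d \<delta> (sphere (0 :: 'a) 1)
        \<le> ennreal (t ^ d) * ((\<Sum>n. hausdorff_weight d (V n)) + (\<Sum>n. hausdorff_weight d (W n)))"
      by (rule mult_left_mono) simp
    also have "\<dots> = (\<Sum>n. ennreal (t ^ d) * hausdorff_weight d (V n)) + (\<Sum>n. ennreal (t ^ d) * hausdorff_weight d (W n))"
      by (simp add: distrib_left)
    also have "\<dots> \<le> (\<Sum>n. F n t) + (\<Sum>n. F' n t)"
      using V W by (intro add_mono suminf_le) auto
    finally show ?thesis .
  qed

  have [measurable]: "F n \<in> borel_measurable borel" "F' n \<in> borel_measurable borel" for n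
    unfolding F_def F'_def by measurable
  have "(\<integral>\<^sup>+t. ennreal (t ^ d) * indicator {1 / 2..1} t \<partial>lborel) = ennreal (1 ^ Suc d / Suc d - (1 / 2) ^ Suc d / Suc d)"
    by (intro nn_integral_FTC_Icc) (auto intro!: derivative_eq_intros simp del: power_Suc)
  also have "\<dots> = ennreal ((1 - (1 / 2) ^ Suc d) / Suc d)" by (simp add: diff_divide_distrib)
  finally have "hausdorff_content d \<delta> (sphere (0 :: 'a) 1) * ennreal ((1 - (1 / 2) ^ Suc d) / Suc d)
      = hausdorff_content d \<delta> (sphere (0 :: 'a) 1) * (\<integral>\<^sup>+t. ennreal (t ^ d) * indicator {1 / 2..1} t \<partial>lborel)"
    by simp
  also have "\<dots> = (\<integral>\<^sup>+t. hausdorff_content d \<delta> (sphere (0 :: 'a) 1) * (ennreal (t ^ d) * indicator {1 / 2..1} t) \<partial>lborel)"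
    by (rule nn_integral_cmult[symmetric]) measurable
  also have "\<dots> \<le> (\<integral>\<^sup>+t. (\<Sum>n. F n t) + (\<Sum>n. F' n t) \<partial>lborel)"
  proof (rule nn_integral_mono_AE)
    \<comment> \<open>The covers exist only for \<open>t\<close> in the open interval; its two
      endpoints are a null set.\<close>
    have le: "hausdorff_content d \<delta> (sphere (0 :: 'a) 1) * (ennreal (t ^ d) * indicator {1 / 2..1} t)
        \<le> (\<Sum>n. F n t) + (\<Sum>n. F' n t)" if "t \<noteq> 1" "t \<noteq> 1 / 2" for t
    proof (cases "1 / 2 < t \<and> t < 1")
      case True
      then show ?thesis using content[of t] by (simp add: mult.commute)
    next
      case False
      then have "t \<notin> {1 / 2..1}" using that by auto
      then show ?thesis by simp
    qed
    show "AE t in lborel. hausdorff_content d \<delta> (sphere (0 :: 'a) 1) * (ennreal (t ^ d) * indicator {1 / 2..1} t)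
        \<le> (\<Sum>n. F n t) + (\<Sum>n. F' n t)"
      using AE_lborel_singleton[of 1] AE_lborel_singleton[of "1 / 2"] by eventually_elim (rule le)
  qed
  also have "\<dots> = (\<Sum>n. \<integral>\<^sup>+t. F n t \<partial>lborel) + (\<Sum>n. \<integral>\<^sup>+t. F' n t \<partial>lborel)"
    by (simp add: nn_integral_add nn_integral_suminf)
  finally have main: "hausdorff_content d \<delta> (sphere (0 :: 'a) 1) * ennreal ((1 - (1 / 2) ^ Suc d) / Suc d)
    \<le> (\<Sum>n. \<integral>\<^sup>+t. F n t \<partial>lborel) + (\<Sum>n. \<integral>\<^sup>+t. F' n t \<partial>lborel)" .
  \<comment> \<open>The slices reassemble to the volume of the ball, and disjointness then bounds
    the sum by the volume of the shell.\<close>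
  have "(\<lambda>n. \<integral>\<^sup>+t. F n t \<partial>lborel) = (\<lambda>n. ennreal ((1 + \<delta>) ^ d) * emeasure lborel (ball (c n) (r n)))"
  proof
    fix n
    show "(\<integral>\<^sup>+t. F n t \<partial>lborel) = ennreal ((1 + \<delta>) ^ d) * emeasure lborel (ball (c n) (r n))"
      unfolding F_def emeasure_ball[OF r0(1)] dim
      by (subst nn_integral_cmult) (simp_all only: nn_integral_ball_slices[OF r0(1)], measurable)
  qed
  then have "(\<Sum>n. \<integral>\<^sup>+t. F n t \<partial>lborel) = (\<Sum>n. ennreal ((1 + \<delta>) ^ d) * emeasure lborel (ball (c n) (r n)))"
    by (simp only:)
  also have "\<dots> = ennreal ((1 + \<delta>) ^ d) * emeasure lborel (\<Union>n. ball (c n) (r n))"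
    unfolding ennreal_suminf_cmult by (subst suminf_emeasure) (auto simp: cr(3))
  also have "\<dots> \<le> ennreal ((1 + \<delta>) ^ d) * emeasure lborel G"
    using G sub(1) by (intro mult_left_mono emeasure_mono UN_least) auto
  also have "\<dots> = ennreal ((1 + \<delta>) ^ d * (\<omega> * (1 - (1 / 2) ^ Suc d)))"
    using \<delta> by (simp add: volG ennreal_mult'[symmetric])
  finally have 1: "(\<Sum>n. \<integral>\<^sup>+t. F n t \<partial>lborel) \<le> ennreal ((1 + \<delta>) ^ d * (\<omega> * (1 - (1 / 2) ^ Suc d)))" .
  have "(\<lambda>n. \<integral>\<^sup>+t. F' n t \<partial>lborel)
    = (\<lambda>n. ennreal (2 * unit_ball_vol (real d) * 5 ^ Suc d / \<omega>) * emeasure lborel (ball (c' n) (r' n)))"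
  proof
    fix n
    \<comment> \<open>The interval has length \<open>10 * r' n\<close>, and
      \<open>10 * 5 ^ d = 2 * 5 ^ Suc d\<close>. Division by \<omega> expresses the result through
      the original balls, which are disjoint and contained in \<open>T\<close>.\<close>
    have "(\<integral>\<^sup>+t. F' n t \<partial>lborel) = ennreal (unit_ball_vol (real d) * (5 * r' n) ^ d) * ennreal (10 * r' n)"
      unfolding F'_def using r0(2)[of n] by (subst nn_integral_cmult_indicator) auto
    also have "\<dots> = ennreal (2 * unit_ball_vol (real d) * 5 ^ Suc d / \<omega>) * ennreal (\<omega> * r' n ^ Suc d)"
      using \<omega> r0(2)[of n] by (simp add: ennreal_mult'[symmetric] power_mult_distrib mult_ac)
    finally show "(\<integral>\<^sup>+t. F' n t \<partial>lborel)
        = ennreal (2 * unit_ball_vol (real d) * 5 ^ Suc d / \<omega>) * emeasure lborel (ball (c' n) (r' n))"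
      unfolding emeasure_ball[OF r0(2)] dim \<omega>_def .
  qed
  then have "(\<Sum>n. \<integral>\<^sup>+t. F' n t \<partial>lborel)
    = (\<Sum>n. ennreal (2 * unit_ball_vol (real d) * 5 ^ Suc d / \<omega>) * emeasure lborel (ball (c' n) (r' n)))"
    by (simp only:)
  also have "\<dots> = ennreal (2 * unit_ball_vol (real d) * 5 ^ Suc d / \<omega>) * emeasure lborel (\<Union>n. ball (c' n) (r' n))"
    unfolding ennreal_suminf_cmult by (subst suminf_emeasure) (auto simp: cr'(3))
  also have "\<dots> \<le> ennreal (2 * unit_ball_vol (real d) * 5 ^ Suc d / \<omega>) * emeasure lborel T"
    using T(1) sub(2) by (intro mult_left_mono emeasure_mono UN_least) auto
  also have "\<dots> \<le> ennreal (2 * unit_ball_vol (real d) * 5 ^ Suc d / \<omega>) * ennreal e"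
    using T by (intro mult_left_mono) auto
  also have "\<dots> = ennreal (2 * unit_ball_vol (real d) * 5 ^ Suc d / \<omega> * e)"
    using \<omega> e by (simp only: ennreal_mult'')
  finally have "(\<Sum>n. \<integral>\<^sup>+t. F' n t \<partial>lborel) \<le> ennreal (2 * unit_ball_vol (real d) * 5 ^ Suc d / \<omega> * e)" .
  from order_trans[OF main add_mono[OF 1 this]] show ?thesis by (simp only: \<omega>_def)
qed

text \<open>The error term is linear in \<open>e\<close> and disappears. The factor
  \<open>1 - (1 / 2) ^ Suc d\<close> comes from the volume of the shell on one side and from the
  integral of \<open>t ^ d\<close> on the other, and cancels.\<close>

lemma hausdorff_content_sphere_le:
  assumes \<delta>: "0 < \<delta>" "\<delta> \<le> 1 / 2" and dim: "DIM('a::euclidean_space) = Suc d"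
  shows "hausdorff_content d \<delta> (sphere (0 :: 'a) 1) \<le> ennreal ((1 + \<delta>) ^ d * (Suc d * unit_ball_vol (real (Suc d))))"
proof -
  define \<omega> where "\<omega> = unit_ball_vol (real (Suc d))"
  have \<omega>: "0 < \<omega>" by (simp add: \<omega>_def)
  define q where "q = (1 - (1 / 2) ^ Suc d) / real (Suc d)"
  define \<kappa> where "\<kappa> = 2 * unit_ball_vol (real d) * 5 ^ Suc d / \<omega>"
  have \<kappa>: "0 < \<kappa>" using \<omega> by (simp add: \<kappa>_def)
  have "(1 / 2 :: real) ^ Suc d < 1" by (rule power_Suc_less_one) auto
  then have q: "0 < q" unfolding q_def by (intro divide_pos_pos) auto
  have "hausdorff_content d \<delta> (sphere (0 :: 'a) 1) * ennreal q
    \<le> ennreal ((1 + \<delta>) ^ d * (\<omega> * (1 - (1 / 2) ^ Suc d)))"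
  proof (rule ennreal_le_epsilon)
    fix e :: real assume "0 < e"
    \<comment> \<open>\<kappa> is the coefficient of the error term, so the choice
      \<open>e / \<kappa>\<close> makes that term equal to \<open>e\<close>.\<close>
    then have "0 < e / \<kappa>" using \<kappa> by simp
    from hausdorff_content_sphere_le_aux[OF \<delta> this dim]
    show "hausdorff_content d \<delta> (sphere (0 :: 'a) 1) * ennreal q
      \<le> ennreal ((1 + \<delta>) ^ d * (\<omega> * (1 - (1 / 2) ^ Suc d))) + ennreal e"
      unfolding \<omega>_def[symmetric] \<kappa>_def[symmetric] q_def using \<kappa> by simp
  qed
  also have "(1 + \<delta>) ^ d * (\<omega> * (1 - (1 / 2) ^ Suc d)) = (1 + \<delta>) ^ d * (Suc d * \<omega>) * q"
    by (simp add: q_def)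
  finally have "hausdorff_content d \<delta> (sphere (0 :: 'a) 1) * ennreal q * ennreal (1 / q)
      \<le> ennreal ((1 + \<delta>) ^ d * (Suc d * \<omega>) * q) * ennreal (1 / q)"
    by (rule mult_right_mono) simp
  then show ?thesis
    using q \<delta> \<omega> by (simp add: mult.assoc ennreal_mult'[symmetric] \<omega>_def)
qed

text \<open>In the upper bound \<delta> stays fixed: the content only grows when the scale shrinks
  to \<eta>, and the factor \<open>(1 + \<eta>) ^ d\<close> tends to 1.\<close>

theorem hausdorff_measure_sphere:
  "hausdorff_measure (CARD('n) - 1) (sphere (0 :: real ^ 'n) 1) = ennreal (CARD('n) * unit_ball_vol (real CARD('n)))"
proof (rule antisym)
  define d where "d = CARD('n) - 1"
  have d: "CARD('n) = Suc d" using zero_less_card_finite[where 'a='n] by (simp add: d_def)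
  show "hausdorff_measure (CARD('n) - 1) (sphere (0 :: real ^ 'n) 1) \<le> ennreal (CARD('n) * unit_ball_vol (real CARD('n)))"
    unfolding hausdorff_measure_def
  proof (rule SUP_least)
    fix \<delta> :: real assume "\<delta> \<in> {0<..}"
    then have \<delta>: "0 < \<delta>" by simp
    show "hausdorff_content (CARD('n) - 1) \<delta> (sphere (0 :: real ^ 'n) 1) \<le> ennreal (CARD('n) * unit_ball_vol (real CARD('n)))"
    proof (rule tendsto_lowerbound)
      have "((\<lambda>\<eta>::real. (1 + \<eta>) ^ d * (CARD('n) * unit_ball_vol (real CARD('n)))) \<longlongrightarrow>
          (1 + 0) ^ d * (CARD('n) * unit_ball_vol (real CARD('n)))) (at_right 0)"
        by (intro tendsto_intros)
      then show "((\<lambda>\<eta>::real. ennreal ((1 + \<eta>) ^ d * (CARD('n) * unit_ball_vol (real CARD('n))))) \<longlongrightarrow>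
          ennreal (CARD('n) * unit_ball_vol (real CARD('n)))) (at_right 0)"
        by (intro tendsto_ennrealI) simp
      show "\<forall>\<^sub>F \<eta>::real in at_right 0. hausdorff_content (CARD('n) - 1) \<delta> (sphere (0 :: real ^ 'n) 1)
        \<le> ennreal ((1 + \<eta>) ^ d * (CARD('n) * unit_ball_vol (real CARD('n))))"
        unfolding eventually_at_right_field
      proof (intro exI[of _ "min \<delta> (1 / 2)"] conjI allI impI)
        fix \<eta> :: real assume \<eta>: "0 < \<eta>" "\<eta> < min \<delta> (1 / 2)"
        have "hausdorff_content (CARD('n) - 1) \<delta> (sphere (0 :: real ^ 'n) 1)
            \<le> hausdorff_content d \<eta> (sphere (0 :: real ^ 'n) 1)"
          unfolding d_def using \<eta> by (intro hausdorff_content_antimono) simp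
        also have "\<dots> \<le> ennreal ((1 + \<eta>) ^ d * (Suc d * unit_ball_vol (real (Suc d))))"
          using \<eta> d by (intro hausdorff_content_sphere_le) simp_all
        finally show "hausdorff_content (CARD('n) - 1) \<delta> (sphere (0 :: real ^ 'n) 1)
            \<le> ennreal ((1 + \<eta>) ^ d * (CARD('n) * unit_ball_vol (real CARD('n))))"
          unfolding d .
      qed (use \<delta> in simp)
    qed simp
  qed
qed (rule hausdorff_measure_sphere_ge)

section \<open>Asymptotics of the interaction\<close>

text \<open>Layer-cake formula: with \<open>p = DIM('a) + s\<close>, the kernel is the integral of
  \<open>p * r powr (- p - 1)\<close> over \<open>r \<ge> norm y\<close>. Exchanging the integrals
  leaves the volume of the shell between the radii 1 and \<open>r\<close>, and a one-dimensional
  integral in \<open>r\<close>.\<close>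

lemma nn_integral_radial_tail:
  fixes s :: real
  assumes s: "0 < s"
  shows "(\<integral>\<^sup>+(y::'a::euclidean_space). ennreal (1 / norm y powr (real DIM('a) + s)) * indicator (- ball 0 1) y \<partial>lborel)
    = ennreal (real DIM('a) * unit_ball_vol (real DIM('a)) / s)"
proof -
  define \<omega> where "\<omega> = unit_ball_vol (real DIM('a))"
  define p where "p = real DIM('a) + s"
  have \<omega>: "0 < \<omega>" by (simp add: \<omega>_def)
  have p: "0 < p" "s < p" using s by (simp_all add: p_def)
  have layer: "ennreal (1 / a powr p) = (\<integral>\<^sup>+r. ennreal (p * r powr (- p - 1)) * indicator {a..} r \<partial>lborel)"
    if "1 \<le> a" for a
  proof -
    have "(\<integral>\<^sup>+r. ennreal (p * r powr (- p - 1)) * indicator {a..} r \<partial>lborel) = ennreal (0 - (- (a powr - p)))"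
    proof (rule nn_integral_FTC_atLeast)
      show "((\<lambda>r. - (r powr - p)) has_field_derivative p * r powr (- p - 1)) (at r)" if "a \<le> r" for r
        using that \<open>1 \<le> a\<close> by (auto intro!: derivative_eq_intros)
      show "((\<lambda>r. - (r powr - p)) \<longlongrightarrow> 0) at_top"
        using tendsto_minus[OF tendsto_neg_powr[of "- p", OF _ filterlim_ident]] p by simp
    qed (use p in auto)
    then show ?thesis by (simp add: powr_minus_divide)
  qed
  have "(\<integral>\<^sup>+(y::'a). ennreal (1 / norm y powr p) * indicator (- ball 0 1) y \<partial>lborel)
    = (\<integral>\<^sup>+(y::'a). (\<integral>\<^sup>+r. ennreal (p * r powr (- p - 1)) * (indicator {1..} (norm y) * indicator {norm y..} r) \<partial>lborel) \<partial>lborel)"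
  proof (rule nn_integral_cong)
    fix y :: 'a
    show "ennreal (1 / norm y powr p) * indicator (- ball 0 1) y
      = (\<integral>\<^sup>+r. ennreal (p * r powr (- p - 1)) * (indicator {1..} (norm y) * indicator {norm y..} r) \<partial>lborel)"
      using layer[of "norm y"] by (cases "1 \<le> norm y") (auto simp: indicator_def)
  qed
  also have "\<dots> = (\<integral>\<^sup>+r. (\<integral>\<^sup>+(y::'a). ennreal (p * r powr (- p - 1)) * (indicator {1..} (norm y) * indicator {norm y..} r) \<partial>lborel) \<partial>lborel)"
  proof (rule lborel_pair.Fubini')
    \<comment> \<open>Written as \<open>0 \<le> r - norm y\<close>, the condition on the pair is
      visibly jointly measurable.\<close>
    have "(\<lambda>x::real \<times> 'a. ennreal (p * fst x powr (- p - 1)) * (indicator {1..} (norm (snd x)) * indicator {0..} (fst x - norm (snd x))))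
        \<in> borel_measurable (lborel \<Otimes>\<^sub>M lborel)"
      by measurable
    also have "(\<lambda>x::real \<times> 'a. ennreal (p * fst x powr (- p - 1)) * (indicator {1..} (norm (snd x)) * indicator {0..} (fst x - norm (snd x))))
      = (\<lambda>(r, y). ennreal (p * r powr (- p - 1)) * (indicator {1..} (norm y) * indicator {norm y..} r))"
      by (auto simp: indicator_def fun_eq_iff)
    finally show "(\<lambda>(r, y::'a). ennreal (p * r powr (- p - 1)) * (indicator {1..} (norm y) * indicator {norm y..} r))
      \<in> borel_measurable (lborel \<Otimes>\<^sub>M lborel)" .
  qed
  also have "\<dots> = (\<integral>\<^sup>+r. ennreal (p * \<omega> * (r powr (- s - 1) - r powr (- p - 1))) * indicator {1..} r \<partial>lborel)"
  proof (rule nn_integral_cong)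
    fix r :: real
    show "(\<integral>\<^sup>+(y::'a). ennreal (p * r powr (- p - 1)) * (indicator {1..} (norm y) * indicator {norm y..} r) \<partial>lborel)
      = ennreal (p * \<omega> * (r powr (- s - 1) - r powr (- p - 1))) * indicator {1..} r"
    proof (cases "1 \<le> r")
      case True
      have "(\<integral>\<^sup>+(y::'a). ennreal (p * r powr (- p - 1)) * (indicator {1..} (norm y) * indicator {norm y..} r) \<partial>lborel)
        = (\<integral>\<^sup>+y. ennreal (p * r powr (- p - 1)) * indicator (cball (0::'a) r - ball 0 1) y \<partial>lborel)"
        by (intro nn_integral_cong) (auto simp: indicator_def)
      also have "\<dots> = ennreal (p * r powr (- p - 1)) * emeasure lborel (cball (0::'a) r - ball 0 1)"
        by (rule nn_integral_cmult_indicator) simp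
      also have "emeasure lborel (cball (0::'a) r - ball 0 1) = emeasure lborel (cball (0::'a) r) - emeasure lborel (ball (0::'a) 1)"
        using True by (intro emeasure_Diff) (auto simp: emeasure_ball)
      also have "\<dots> = ennreal (\<omega> * r ^ DIM('a) - \<omega>)"
        using True \<omega> by (simp add: emeasure_ball emeasure_cball \<omega>_def[symmetric] ennreal_minus)
      also have "ennreal (p * r powr (- p - 1)) * ennreal (\<omega> * r ^ DIM('a) - \<omega>)
          = ennreal (p * r powr (- p - 1) * (\<omega> * r ^ DIM('a) - \<omega>))"
        using True p by (intro ennreal_mult'[symmetric]) auto
      also have "p * r powr (- p - 1) * (\<omega> * r ^ DIM('a) - \<omega>) = p * \<omega> * (r powr (- s - 1) - r powr (- p - 1))"
      proof -
        have "r powr (- p - 1) * r ^ DIM('a) = r powr (- s - 1)"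
          using True by (simp add: p_def powr_realpow[symmetric] powr_add[symmetric])
        then show ?thesis by (simp add: algebra_simps)
      qed
      finally show ?thesis using True by simp
    next
      case False
      then have "indicator {1..} (norm y) * indicator {norm y..} r = (0::ennreal)" for y :: 'a
        by (auto simp: indicator_def)
      then show ?thesis using False by (simp only: mult_zero_right nn_integral_const) simp
    qed
  qed
  also have "\<dots> = ennreal (0 - p * \<omega> * (- (1 powr - s) / s + 1 powr - p / p))"
  proof (rule nn_integral_FTC_atLeast)
    show "((\<lambda>r. p * \<omega> * (- (r powr - s) / s + r powr - p / p)) has_field_derivative
        p * \<omega> * (r powr (- s - 1) - r powr (- p - 1))) (at r)" if "1 \<le> r" for r
      using that s p by (auto intro!: derivative_eq_intros simp: field_simps)
    show "0 \<le> p * \<omega> * (r powr (- s - 1) - r powr (- p - 1))" if "1 \<le> r" for r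
      using that p \<omega> by (intro mult_nonneg_nonneg) (auto intro!: powr_mono)
    have "((\<lambda>r. p * \<omega> * (- (r powr - s) / s + r powr - p / p)) \<longlongrightarrow> p * \<omega> * (- 0 / s + 0 / p)) at_top"
      using s p by (intro tendsto_intros tendsto_neg_powr filterlim_ident) auto
    then show "((\<lambda>r. p * \<omega> * (- (r powr - s) / s + r powr - p / p)) \<longlongrightarrow> 0) at_top" by simp
  qed simp
  \<comment> \<open>The value is
    \<open>p * \<omega> * (1 / s - 1 / p) = \<omega> * (p - s) / s\<close>, and \<open>p - s\<close>
    is the dimension.\<close>
  also have "0 - p * \<omega> * (- (1 powr - s) / s + 1 powr - p / p) = real DIM('a) * \<omega> / s"
    using s p(1) by (simp add: field_simps) (simp add: p_def algebra_simps)
  finally show ?thesis by (simp only: p_def \<omega>_def)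
qed

text \<open>The two kernels differ by the factor \<open>norm z powr (s0 - s)\<close>, at most
  \<open>\<rho> powr s0\<close> uniformly in \<open>s\<close> because \<open>1 \<le> \<rho>\<close>.
  At \<open>z = 0\<close> both sides are 0 by division by zero.\<close>

lemma powr_kernel_near:
  fixes z :: "'a::real_normed_vector"
  assumes "0 < s" "s \<le> s0" "norm z \<le> \<rho>" "1 \<le> \<rho>"
  shows "1 / norm z powr (n + s) \<le> \<rho> powr s0 * (1 / norm z powr (n + s0))"
proof (cases "z = 0")
  case False
  then have z: "0 < norm z" by simp
  have "1 / norm z powr (n + s) = norm z powr (s0 - s) * (1 / norm z powr (n + s0))"
    using z by (simp add: powr_diff powr_add field_simps)
  also have "\<dots> \<le> \<rho> powr s0 * (1 / norm z powr (n + s0))"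
  proof (rule mult_right_mono)
    have "norm z powr (s0 - s) \<le> \<rho> powr (s0 - s)" using assms z by (intro powr_mono2) auto
    also have "\<dots> \<le> \<rho> powr s0" using assms by (intro powr_mono) auto
    finally show "norm z powr (s0 - s) \<le> \<rho> powr s0" .
  qed simp
  finally show ?thesis .
qed simp

text \<open>\<open>norm (x - y)\<close> lies between \<open>(1 - M / R) * norm y\<close> and
  \<open>(1 + M / R) * norm y\<close>. The exponent \<open>n + 1\<close> in place of
  \<open>n + s\<close> makes the constants independent of \<open>s\<close>; they tend to 1 as
  \<open>R\<close> grows.\<close>

lemma powr_kernel_far:
  fixes x y :: "'a::real_normed_vector"
  assumes n: "0 \<le> n" and s: "0 < s" "s \<le> 1" and x: "norm x \<le> M" and y: "R < norm y" and M: "0 \<le> M" "M < R"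
  shows "1 / norm (x - y) powr (n + s) \<le> (1 / (1 - M / R) powr (n + 1)) * (1 / norm y powr (n + s))"
    and "1 / norm y powr (n + s) \<le> (1 + M / R) powr (n + 1) * (1 / norm (x - y) powr (n + s))"
proof -
  have R: "0 < R" using M by simp
  have y0: "0 < norm y" using y R by linarith
  have q: "0 < 1 - M / R" "1 - M / R \<le> 1" using M R by auto
  have MR: "M \<le> M / R * norm y" using mult_left_mono[of R "norm y" "M / R"] y M R by simp
  have lo: "(1 - M / R) * norm y \<le> norm (x - y)"
    using norm_triangle_ineq2[of y x] x MR by (simp add: algebra_simps norm_minus_commute)
  have hi: "norm (x - y) \<le> (1 + M / R) * norm y"
    using norm_triangle_ineq4[of x y] x MR by (simp add: algebra_simps)
  have pos: "0 < norm (x - y)" using lo q y0 mult_pos_pos[of "1 - M / R" "norm y"] by linarith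
  have "(1 - M / R) powr (n + 1) * norm y powr (n + s) \<le> (1 - M / R) powr (n + s) * norm y powr (n + s)"
    using q s by (intro mult_right_mono powr_mono') auto
  also have "\<dots> = ((1 - M / R) * norm y) powr (n + s)" using q by (simp add: powr_mult)
  also have "\<dots> \<le> norm (x - y) powr (n + s)" using lo q n s by (intro powr_mono2) auto
  finally show "1 / norm (x - y) powr (n + s) \<le> (1 / (1 - M / R) powr (n + 1)) * (1 / norm y powr (n + s))"
    using q y0 pos by (simp add: divide_simps mult.commute)
  have "norm (x - y) powr (n + s) \<le> ((1 + M / R) * norm y) powr (n + s)" using hi n s by (intro powr_mono2) auto
  also have "\<dots> = (1 + M / R) powr (n + s) * norm y powr (n + s)" using M R by (simp add: powr_mult)
  also have "\<dots> \<le> (1 + M / R) powr (n + 1) * norm y powr (n + s)"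
    using M R s by (intro mult_right_mono powr_mono) auto
  finally show "1 / norm y powr (n + s) \<le> (1 + M / R) powr (n + 1) * (1 / norm (x - y) powr (n + s))"
    using y0 pos by (simp add: divide_simps mult.commute)
qed

section \<open>Mass of a set near infinity\<close>

text \<open>The factor \<open>s\<close> is left out: \<open>s * tail_mass s E\<close> is the
  quantity whose limit the theorem calls \<alpha>.\<close>

definition tail_mass :: "real \<Rightarrow> 'a::euclidean_space set \<Rightarrow> ennreal" where
  "tail_mass s B = (\<integral>\<^sup>+y. ennreal (1 / norm y powr (real DIM('a) + s)) * indicator (B \<inter> - ball 0 1) y \<partial>lborel)"

lemma tail_mass_le: "0 < s \<Longrightarrow> tail_mass s (B :: 'a::euclidean_space set) \<le> ennreal (real DIM('a) * unit_ball_vol (real DIM('a)) / s)"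
  unfolding tail_mass_def nn_integral_radial_tail[symmetric]
  by (intro nn_integral_mono mult_left_mono) (auto simp: indicator_def)

lemma tail_mass_Un:
  fixes B C :: "'a::euclidean_space set"
  assumes [measurable]: "B \<in> sets borel" "C \<in> sets borel" and "B \<inter> C = {}"
  shows "tail_mass s (B \<union> C) = tail_mass s B + tail_mass s C"
proof -
  have "tail_mass s (B \<union> C) = (\<integral>\<^sup>+(y::'a). ennreal (1 / norm y powr (real DIM('a) + s)) * indicator (B \<inter> - ball 0 1) y
      + ennreal (1 / norm y powr (real DIM('a) + s)) * indicator (C \<inter> - ball 0 1) y \<partial>lborel)"
    unfolding tail_mass_def using assms(3) by (intro nn_integral_cong) (auto simp: indicator_def)
  also have "\<dots> = tail_mass s B + tail_mass s C"
    unfolding tail_mass_def by (intro nn_integral_add) measurable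
  finally show ?thesis .
qed

lemma tail_mass_le_emeasure:
  fixes B :: "'a::euclidean_space set"
  assumes "B \<in> sets borel" "0 < s"
  shows "tail_mass s B \<le> emeasure lborel B"
proof -
  have "tail_mass s B \<le> (\<integral>\<^sup>+y. indicator B y \<partial>lborel)"
    unfolding tail_mass_def
  proof (rule nn_integral_mono)
    fix y :: 'a
    have "1 / norm y powr (real DIM('a) + s) \<le> 1" if "1 \<le> norm y"
      using ge_one_powr_ge_zero[OF that, of "real DIM('a) + s"] assms(2) by (simp add: divide_le_eq_1)
    then show "ennreal (1 / norm y powr (real DIM('a) + s)) * indicator (B \<inter> - ball 0 1) y \<le> indicator B y"
      by (auto simp: indicator_def ennreal_le_1)
  qed
  then show ?thesis using assms(1) by simp
qed

section \<open>Interaction of a bounded set with an arbitrary one\<close>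

lemma interaction_lborel:
  "interaction s A B = (\<integral>\<^sup>+x. (\<integral>\<^sup>+y. ennreal (1 / norm (x - y) powr (real DIM('a) + s)) * indicator B y \<partial>lborel)
      * indicator A (x :: 'a::euclidean_space) \<partial>lborel)"
  unfolding interaction_def by (simp add: nn_integral_completion)

lemma interaction_commute:
  fixes A B :: "'a::euclidean_space set"
  assumes [measurable]: "A \<in> sets borel" "B \<in> sets borel"
  shows "interaction s A B = interaction s B A"
proof -
  have "interaction s A B = (\<integral>\<^sup>+x. (\<integral>\<^sup>+y. ennreal (1 / norm (x - y) powr (real DIM('a) + s)) * indicator B y * indicator A x \<partial>lborel) \<partial>lborel)"
    unfolding interaction_lborel by (intro nn_integral_cong nn_integral_multc[symmetric]) measurable
  also have "\<dots> = (\<integral>\<^sup>+y. (\<integral>\<^sup>+x. ennreal (1 / norm (x - y) powr (real DIM('a) + s)) * indicator B y * indicator A x \<partial>lborel) \<partial>lborel)"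
    by (rule lborel_pair.Fubini') measurable
  also have "\<dots> = (\<integral>\<^sup>+y. (\<integral>\<^sup>+x. ennreal (1 / norm (y - x) powr (real DIM('a) + s)) * indicator A x * indicator B y \<partial>lborel) \<partial>lborel)"
    by (simp add: norm_minus_commute mult_ac)
  also have "\<dots> = interaction s B A"
    unfolding interaction_lborel by (intro nn_integral_cong nn_integral_multc) measurable
  finally show ?thesis .
qed

text \<open>Allows a Lebesgue measurable set to be exchanged for a Borel one.\<close>

lemma interaction_cong_AE:
  fixes A B :: "'a::euclidean_space set"
  assumes "AE x in lborel. x \<in> A \<longleftrightarrow> x \<in> A'" "AE x in lborel. x \<in> B \<longleftrightarrow> x \<in> B'"
  shows "interaction s A B = interaction s A' B'"
proof -
  have eq: "(\<integral>\<^sup>+y. ennreal (1 / norm (x - y) powr (real DIM('a) + s)) * indicator B y \<partial>lborel)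
    = (\<integral>\<^sup>+y. ennreal (1 / norm (x - y) powr (real DIM('a) + s)) * indicator B' y \<partial>lborel)" for x :: 'a
    using assms(2) by (intro nn_integral_cong_AE, eventually_elim) (simp add: indicator_def)
  show ?thesis
    unfolding interaction_lborel eq
    using assms(1) by (intro nn_integral_cong_AE, eventually_elim) (simp add: indicator_def)
qed

text \<open>Points of \<open>B\<close> in \<open>cball 0 R\<close> are within \<open>M + R\<close>
  of \<open>A\<close>, where the kernel with exponent \<open>s0\<close> dominates; beyond
  \<open>R\<close>, \<open>powr_kernel_far\<close> compares with the tail mass. After multiplication
  by \<open>s\<close>, a finite first term vanishes in the limit.\<close>

lemma interaction_le:
  fixes A B :: "'a::euclidean_space set"
  assumes A [measurable]: "A \<in> sets borel" and B [measurable]: "B \<in> sets borel" and AM: "A \<subseteq> cball 0 M"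
    and M: "0 \<le> M" "M < R" "1 \<le> R" and s: "0 < s" "s \<le> s0" "s0 \<le> 1"
  shows "interaction s A B \<le> ennreal ((M + R) powr s0) * interaction s0 A B
    + ennreal (1 / (1 - M / R) powr (real DIM('a) + 1)) * tail_mass s B * emeasure lborel A"
proof -
  let ?n = "real DIM('a)"
  let ?c = "(M + R) powr s0" and ?c' = "1 / (1 - M / R) powr (?n + 1)"
  have inner: "(\<integral>\<^sup>+y. ennreal (1 / norm (x - y) powr (?n + s)) * indicator B y \<partial>lborel)
    \<le> ennreal ?c * (\<integral>\<^sup>+y. ennreal (1 / norm (x - y) powr (?n + s0)) * indicator B y \<partial>lborel) + ennreal ?c' * tail_mass s B"
    if x: "x \<in> A" for x
  proof -
    have nx: "norm x \<le> M" using AM x by auto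
    have "(\<integral>\<^sup>+y. ennreal (1 / norm (x - y) powr (?n + s)) * indicator B y \<partial>lborel)
      \<le> (\<integral>\<^sup>+y. ennreal ?c * (ennreal (1 / norm (x - y) powr (?n + s0)) * indicator B y)
          + ennreal ?c' * (ennreal (1 / norm y powr (?n + s)) * indicator (B \<inter> - ball 0 1) y) \<partial>lborel)"
    proof (rule nn_integral_mono)
      fix y
      show "ennreal (1 / norm (x - y) powr (?n + s)) * indicator B y
        \<le> ennreal ?c * (ennreal (1 / norm (x - y) powr (?n + s0)) * indicator B y)
          + ennreal ?c' * (ennreal (1 / norm y powr (?n + s)) * indicator (B \<inter> - ball 0 1) y)"
      proof (cases "y \<in> B")
        case y: True
        show ?thesis
        proof (cases "norm y \<le> R")
          case True
          then have "norm (x - y) \<le> M + R" using norm_triangle_ineq4[of x y] nx by linarith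
          from powr_kernel_near[OF s(1,2) this, of ?n] M
          have "ennreal (1 / norm (x - y) powr (?n + s)) \<le> ennreal (?c * (1 / norm (x - y) powr (?n + s0)))"
            by (intro ennreal_leI) simp
          then have "ennreal (1 / norm (x - y) powr (?n + s)) \<le> ennreal ?c * ennreal (1 / norm (x - y) powr (?n + s0))"
            by (simp only: ennreal_mult' powr_ge_zero)
          then show ?thesis using y by (intro add_increasing2) simp_all
        next
          case False
          then have Ry: "R < norm y" by simp
          have "y \<in> B \<inter> - ball 0 1" using y Ry M by auto
          moreover have "ennreal (1 / norm (x - y) powr (?n + s)) \<le> ennreal (?c' * (1 / norm y powr (?n + s)))"
            using powr_kernel_far(1)[OF _ s(1) _ nx Ry M(1,2), of ?n] s by (intro ennreal_leI) simp
          then have "ennreal (1 / norm (x - y) powr (?n + s)) \<le> ennreal ?c' * ennreal (1 / norm y powr (?n + s))"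
            by (simp only: ennreal_mult' powr_ge_zero zero_le_divide_1_iff)
          ultimately show ?thesis using y by (intro add_increasing) simp_all
        qed
      qed simp
    qed
    also have "\<dots> = ennreal ?c * (\<integral>\<^sup>+y. ennreal (1 / norm (x - y) powr (?n + s0)) * indicator B y \<partial>lborel) + ennreal ?c' * tail_mass s B"
      unfolding tail_mass_def by (simp add: nn_integral_add nn_integral_cmult)
    finally show ?thesis .
  qed
  have "interaction s A B \<le> (\<integral>\<^sup>+x. ennreal ?c * ((\<integral>\<^sup>+y. ennreal (1 / norm (x - y) powr (?n + s0)) * indicator B y \<partial>lborel) * indicator A x)
      + ennreal ?c' * tail_mass s B * indicator A x \<partial>lborel)"
    unfolding interaction_lborel using inner by (intro nn_integral_mono) (auto simp: indicator_def)
  also have "\<dots> = ennreal ?c * interaction s0 A B + ennreal ?c' * tail_mass s B * emeasure lborel A"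
    unfolding interaction_lborel by (simp add: nn_integral_add nn_integral_cmult)
  finally show ?thesis .
qed

text \<open>Between the radii 1 and \<open>R\<close> the integrand of the tail mass is at most 1 and
  contributes at most the volume of \<open>cball 0 R\<close>; beyond \<open>R\<close> the second
  half of \<open>powr_kernel_far\<close> applies.\<close>

lemma interaction_ge:
  fixes A B :: "'a::euclidean_space set"
  assumes A [measurable]: "A \<in> sets borel" and B [measurable]: "B \<in> sets borel" and AM: "A \<subseteq> cball 0 M"
    and M: "0 \<le> M" "M < R" "1 \<le> R" and s: "0 < s" "s \<le> 1"
  shows "tail_mass s B * emeasure lborel A \<le> ennreal ((1 + M / R) powr (real DIM('a) + 1)) * interaction s A B
    + emeasure lborel (cball (0 :: 'a) R) * emeasure lborel A"
proof -
  let ?n = "real DIM('a)"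
  let ?c = "(1 + M / R) powr (?n + 1)"
  have inner: "tail_mass s B
    \<le> ennreal ?c * (\<integral>\<^sup>+y. ennreal (1 / norm (x - y) powr (?n + s)) * indicator B y \<partial>lborel) + emeasure lborel (cball (0 :: 'a) R)"
    if x: "x \<in> A" for x
  proof -
    have nx: "norm x \<le> M" using AM x by auto
    have "tail_mass s B
      \<le> (\<integral>\<^sup>+y. ennreal ?c * (ennreal (1 / norm (x - y) powr (?n + s)) * indicator B y) + indicator (cball 0 R) y \<partial>lborel)"
      unfolding tail_mass_def
    proof (rule nn_integral_mono)
      fix y :: 'a
      show "ennreal (1 / norm y powr (?n + s)) * indicator (B \<inter> - ball 0 1) y
        \<le> ennreal ?c * (ennreal (1 / norm (x - y) powr (?n + s)) * indicator B y) + indicator (cball 0 R) y"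
      proof (cases "y \<in> B \<inter> - ball 0 1")
        case y: True
        show ?thesis
        proof (cases "norm y \<le> R")
          case True
          have "1 / norm y powr (?n + s) \<le> 1"
            using ge_one_powr_ge_zero[of "norm y" "?n + s"] y s by (simp add: divide_le_eq_1)
          then have "ennreal (1 / norm y powr (?n + s)) \<le> 1" by (simp add: ennreal_le_1)
          then show ?thesis using y True by (intro add_increasing) auto
        next
          case False
          then have Ry: "R < norm y" by simp
          have "ennreal (1 / norm y powr (?n + s)) \<le> ennreal (?c * (1 / norm (x - y) powr (?n + s)))"
            using powr_kernel_far(2)[OF _ s nx Ry M(1,2), of ?n] by (intro ennreal_leI) simp
          then have "ennreal (1 / norm y powr (?n + s)) \<le> ennreal ?c * ennreal (1 / norm (x - y) powr (?n + s))"
            by (simp only: ennreal_mult' powr_ge_zero)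
          then show ?thesis using y by (intro add_increasing2) simp_all
        qed
      qed simp
    qed
    also have "\<dots> = ennreal ?c * (\<integral>\<^sup>+y. ennreal (1 / norm (x - y) powr (?n + s)) * indicator B y \<partial>lborel) + emeasure lborel (cball (0 :: 'a) R)"
    proof -
      have 1: "(\<lambda>y. ennreal ?c * (ennreal (1 / norm (x - y) powr (?n + s)) * indicator B y)) \<in> borel_measurable lborel"
        by measurable
      have 2: "(indicator (cball (0 :: 'a) R) :: 'a \<Rightarrow> ennreal) \<in> borel_measurable lborel"
        by (rule borel_measurable_indicator) simp
      show ?thesis by (subst nn_integral_add[OF 1 2]) (simp add: nn_integral_cmult)
    qed
    finally show ?thesis .
  qed
  have "tail_mass s B * emeasure lborel A = (\<integral>\<^sup>+x. tail_mass s B * indicator A x \<partial>lborel)"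
    by (rule nn_integral_cmult_indicator[symmetric]) (use A in simp)
  also have "\<dots> \<le> (\<integral>\<^sup>+x. ennreal ?c * ((\<integral>\<^sup>+y. ennreal (1 / norm (x - y) powr (?n + s)) * indicator B y \<partial>lborel) * indicator A x)
      + emeasure lborel (cball (0 :: 'a) R) * indicator A x \<partial>lborel)"
    using inner by (intro nn_integral_mono) (auto simp: indicator_def)
  also have "\<dots> = ennreal ?c * interaction s A B + emeasure lborel (cball (0 :: 'a) R) * emeasure lborel A"
    unfolding interaction_lborel by (simp add: nn_integral_add nn_integral_cmult)
  finally show ?thesis .
qed

text \<open>After multiplication by \<open>s\<close>, the errors in \<open>interaction_le\<close>
  and \<open>interaction_ge\<close> are either of order \<open>s\<close> for fixed \<open>R\<close>,
  or carry a factor \<open>c2 R - 1\<close> or \<open>c3 R - 1\<close> against bounded quantities.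
  So \<open>R\<close> is chosen first and then \<open>s\<close> tends to 0.\<close>

lemma interaction_asymptotics:
  fixes A B :: "'a::euclidean_space set"
  assumes A: "A \<in> sets borel" and B: "B \<in> sets borel" and bdd: "bounded A"
    and s0: "0 < s0" "s0 \<le> 1" and fin: "interaction s0 A B < \<infinity>"
  shows "\<And>s. 0 < s \<Longrightarrow> s \<le> s0 \<Longrightarrow> interaction s A B < \<infinity>"
    and "((\<lambda>s. s * enn2real (interaction s A B) - measure lborel A * (s * enn2real (tail_mass s B))) \<longlongrightarrow> 0) (at_right 0)"
proof -
  define n where "n = real DIM('a)"
  define N where "N = n * unit_ball_vol n"
  have N: "0 < N" by (simp add: N_def n_def)
  obtain M where M: "0 \<le> M" "A \<subseteq> cball 0 M"
  proof -
    obtain a where "\<And>x. x \<in> A \<Longrightarrow> norm x \<le> a" using bdd by (auto simp: bounded_iff)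
    then show thesis by (intro that[of "max a 0"]) (auto simp: le_max_iff_disj)
  qed
  define a where "a = measure lborel A"
  have a: "0 \<le> a" by (simp add: a_def)
  have ea: "emeasure lborel A = ennreal a"
    using emeasure_bounded_finite[OF bdd] by (simp add: a_def emeasure_eq_ennreal_measure less_top)
  have tail: "tail_mass s B = ennreal (enn2real (tail_mass s B))" "s * enn2real (tail_mass s B) \<le> N"
    if "0 < s" for s
  proof -
    have le: "tail_mass s B \<le> ennreal (N / s)"
      using tail_mass_le[OF that] by (simp add: N_def n_def)
    then show "tail_mass s B = ennreal (enn2real (tail_mass s B))"
      by (simp add: ennreal_enn2real_if) (metis ennreal_neq_top neq_top_trans)
    have "enn2real (tail_mass s B) \<le> N / s"
      using enn2real_mono[OF le] that N by simp
    then show "s * enn2real (tail_mass s B) \<le> N" using that by (simp add: field_simps)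
  qed
  define c1 where "c1 R = (M + R) powr s0" for R
  define c2 where "c2 R = 1 / (1 - M / R) powr (n + 1)" for R
  define c3 where "c3 R = (1 + M / R) powr (n + 1)" for R
  note c_nonneg = c1_def c2_def c3_def
  define I where "I s = enn2real (interaction s A B)" for s
  define t where "t s = enn2real (tail_mass s B)" for s
  define v where "v R = measure lborel (cball (0::'a) R)" for R
  have ev: "emeasure lborel (cball (0::'a) R) = ennreal (v R)" for R
    using emeasure_bounded_finite[OF bounded_cball, of "0::'a" R] by (simp add: v_def emeasure_eq_ennreal_measure less_top)
  have It: "0 \<le> I s" "0 \<le> t s" for s by (simp_all add: I_def t_def)
  have upper0: "interaction s A B \<le> ennreal (c1 R * I s0 + c2 R * t s * a)"
    if "0 < s" "s \<le> s0" "M < R" "1 \<le> R" for s R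
  proof -
    have "interaction s A B \<le> ennreal (c1 R) * interaction s0 A B + ennreal (c2 R) * tail_mass s B * emeasure lborel A"
      unfolding c1_def c2_def n_def by (rule interaction_le[OF A B M(2,1) that(3,4,1,2) s0(2)])
    also have "interaction s0 A B = ennreal (I s0)" using fin by (simp add: I_def less_top)
    also have "tail_mass s B = ennreal (t s)" unfolding t_def by (rule tail(1)[OF that(1)])
    also note ea
    also have "ennreal (c1 R) * ennreal (I s0) + ennreal (c2 R) * ennreal (t s) * ennreal a
        = ennreal (c1 R * I s0 + c2 R * t s * a)"
      using It a by (simp add: ennreal_mult''[symmetric] ennreal_plus[symmetric] c_nonneg del: ennreal_plus)
    finally show ?thesis .
  qed
  show finite: "interaction s A B < \<infinity>" if "0 < s" "s \<le> s0" for s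
    by (rule le_less_trans[OF upper0[OF that, of "M + 1"]]) (use M(1) in auto)
  have upper: "I s \<le> c1 R * I s0 + c2 R * t s * a" if "0 < s" "s \<le> s0" "M < R" "1 \<le> R" for s R
    unfolding I_def[of s] using It a
    by (intro enn2real_leI upper0 that add_nonneg_nonneg mult_nonneg_nonneg) (auto simp: c_nonneg)
  have lower: "t s * a \<le> c3 R * I s + v R * a" if "0 < s" "s \<le> s0" "M < R" "1 \<le> R" for s R
  proof -
    have "ennreal (t s) * ennreal a \<le> ennreal (c3 R) * interaction s A B + ennreal (v R) * ennreal a"
      unfolding c3_def n_def ea[symmetric] ev[symmetric] t_def tail(1)[OF that(1), symmetric]
      using that s0 by (intro interaction_ge[OF A B M(2,1)]) auto
    also have "interaction s A B = ennreal (I s)" using finite[OF that(1,2)] by (simp add: I_def less_top)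
    also have "ennreal (c3 R) * ennreal (I s) + ennreal (v R) * ennreal a = ennreal (c3 R * I s + v R * a)"
      using It a by (simp add: ennreal_mult''[symmetric] ennreal_plus[symmetric] c_nonneg v_def del: ennreal_plus)
    finally have "ennreal (t s * a) \<le> ennreal (c3 R * I s + v R * a)" using a by (simp add: ennreal_mult'')
    then show ?thesis using It a by (subst (asm) ennreal_le_iff) (auto simp: c_nonneg v_def)
  qed
  have MR: "((\<lambda>R. M / R) \<longlongrightarrow> 0) at_top"
    by (rule tendsto_divide_0[OF tendsto_const filterlim_at_top_imp_at_infinity[OF filterlim_ident]])
  have "(c2 \<longlongrightarrow> 1 / (1 - 0) powr (n + 1)) at_top" "(c3 \<longlongrightarrow> (1 + 0) powr (n + 1)) at_top"
    unfolding c2_def[abs_def] c3_def[abs_def] by (intro tendsto_intros MR; simp)+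
  then have c23: "(c2 \<longlongrightarrow> 1) at_top" "(c3 \<longlongrightarrow> 1) at_top" by simp_all
  show "((\<lambda>s. s * enn2real (interaction s A B) - measure lborel A * (s * enn2real (tail_mass s B))) \<longlongrightarrow> 0) (at_right 0)"
    unfolding I_def[symmetric] t_def[symmetric] a_def[symmetric]
  proof (rule tendstoI)
    fix e :: real assume e: "0 < e"
    have "((\<lambda>R. (c2 R - 1) * a * N) \<longlongrightarrow> (1 - 1) * a * N) at_top"
      "((\<lambda>R. (c3 R - 1) * (c2 R * a * N)) \<longlongrightarrow> (1 - 1) * (1 * a * N)) at_top"
      by (intro tendsto_intros c23)+
    then have "\<forall>\<^sub>F R in at_top. (c2 R - 1) * a * N < e" "\<forall>\<^sub>F R in at_top. (c3 R - 1) * (c2 R * a * N) < e"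
      using e by (auto dest: order_tendstoD(2))
    with eventually_gt_at_top[of M] eventually_ge_at_top[of 1]
    have "\<forall>\<^sub>F R in at_top. M < R \<and> 1 \<le> R \<and> (c2 R - 1) * a * N < e \<and> (c3 R - 1) * (c2 R * a * N) < e"
      by eventually_elim simp
    then obtain R where R: "M < R" "1 \<le> R" "(c2 R - 1) * a * N < e" "(c3 R - 1) * (c2 R * a * N) < e"
      by (auto dest!: eventually_happens)
    have c3: "1 \<le> c3 R" unfolding c3_def n_def using M R by (intro ge_one_powr_ge_zero) auto
    have c2: "1 \<le> c2 R"
    proof -
      have "(1 - M / R) powr (n + 1) \<le> 1" unfolding n_def using M R by (intro powr_le1) auto
      moreover have "0 < (1 - M / R) powr (n + 1)" using M R by simp
      ultimately show ?thesis by (simp add: c2_def)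
    qed
    \<comment> \<open>With \<open>R\<close> fixed, the terms that carry a factor \<open>s\<close>
      vanish, so the strict inequalities defining \<open>R\<close> persist for small
      \<open>s\<close>.\<close>
    have "((\<lambda>s. s * (c1 R * I s0) + (c2 R - 1) * a * N) \<longlongrightarrow> 0 * (c1 R * I s0) + (c2 R - 1) * a * N) (at_right 0)"
      "((\<lambda>s. (c3 R - 1) * (s * (c1 R * I s0) + c2 R * a * N) + s * (v R * a)) \<longlongrightarrow>
          (c3 R - 1) * (0 * (c1 R * I s0) + c2 R * a * N) + 0 * (v R * a)) (at_right 0)"
      by (intro tendsto_intros)+
    then have "\<forall>\<^sub>F s in at_right 0. s * (c1 R * I s0) + (c2 R - 1) * a * N < e"
      "\<forall>\<^sub>F s in at_right 0. (c3 R - 1) * (s * (c1 R * I s0) + c2 R * a * N) + s * (v R * a) < e"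
      using R by (auto dest: order_tendstoD(2))
    moreover have "\<forall>\<^sub>F s in at_right 0. 0 < s \<and> s < s0"
      using s0 unfolding eventually_at_right_field by blast
    ultimately show "\<forall>\<^sub>F s in at_right 0. dist (s * I s - a * (s * t s)) 0 < e"
    proof eventually_elim
      case (elim s)
      have ts: "s * t s \<le> N" unfolding t_def using elim by (intro tail(2)) simp
      have ats: "a * (s * t s) \<le> a * N" using ts a by (rule mult_left_mono)
      have "s * I s \<le> s * (c1 R * I s0 + c2 R * t s * a)"
        using elim R by (intro mult_left_mono upper) auto
      then have 1: "s * I s \<le> s * (c1 R * I s0) + c2 R * (a * (s * t s))" by (simp add: algebra_simps)
      have "s * (t s * a) \<le> s * (c3 R * I s + v R * a)"
        using elim R by (intro mult_left_mono lower) auto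
      then have 2: "a * (s * t s) \<le> c3 R * (s * I s) + s * (v R * a)" by (simp add: algebra_simps)
      have "(c2 R - 1) * (a * (s * t s)) \<le> (c2 R - 1) * (a * N)" by (rule mult_left_mono[OF ats]) (use c2 in simp)
      then have 3: "s * I s - a * (s * t s) \<le> s * (c1 R * I s0) + (c2 R - 1) * a * N"
        using 1 by (simp add: algebra_simps)
      \<comment> \<open>The lower estimate has the error \<open>(c3 R - 1) * (s * I s)\<close>, so
        the upper bound on \<open>s * I s\<close> is used once more.\<close>
      have "c2 R * (a * (s * t s)) \<le> c2 R * (a * N)" by (rule mult_left_mono[OF ats]) (use c2 in simp)
      then have "s * I s \<le> s * (c1 R * I s0) + c2 R * a * N" using 1 by (simp add: mult.assoc)
      then have "(c3 R - 1) * (s * I s) \<le> (c3 R - 1) * (s * (c1 R * I s0) + c2 R * a * N)"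
        using c3 by (intro mult_left_mono) auto
      then have "a * (s * t s) - s * I s \<le> (c3 R - 1) * (s * (c1 R * I s0) + c2 R * a * N) + s * (v R * a)"
        using 2 by (simp add: algebra_simps)
      with 3 elim show ?case by (simp add: dist_real_def)
    qed
  qed
qed

lemma tendsto_tail_mass_bounded:
  fixes B :: "'a::euclidean_space set"
  assumes "B \<in> sets borel" "bounded B"
  shows "((\<lambda>s. s * enn2real (tail_mass s B)) \<longlongrightarrow> 0) (at_right 0)"
proof (rule tendsto_sandwich[where f = "\<lambda>_. 0" and h = "\<lambda>s. s * measure lborel B"])
  have pos: "\<forall>\<^sub>F s::real in at_right 0. 0 < s" by (rule eventually_at_right_less)
  then show "\<forall>\<^sub>F s in at_right 0. 0 \<le> s * enn2real (tail_mass s B)" by eventually_elim simp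
  show "\<forall>\<^sub>F s in at_right 0. s * enn2real (tail_mass s B) \<le> s * measure lborel B"
    using pos
  proof eventually_elim
    case (elim s)
    have "emeasure lborel B < \<infinity>" by (rule emeasure_bounded_finite[OF assms(2)])
    then have "enn2real (tail_mass s B) \<le> measure lborel B"
      unfolding measure_def by (intro enn2real_mono tail_mass_le_emeasure[OF assms(1) elim]) simp
    then show ?case using elim by simp
  qed
  have "((\<lambda>s. s * measure lborel B) \<longlongrightarrow> 0 * measure lborel B) (at_right 0)" by (intro tendsto_intros)
  then show "((\<lambda>s. s * measure lborel B) \<longlongrightarrow> 0) (at_right 0)" by simp
qed simp

section \<open>The perimeter and the two claims\<close>

text \<open>By symmetry each of the three interactions has a bounded set in first place. The main
  terms are \<open>a1\<close> times the tail of \<open>- E\<close>, which is \<open>N\<close> minus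
  the tail of \<open>E\<close>, and \<open>a2\<close> times the tail of \<open>E\<close> outside
  \<Omega>.\<close>

lemma s_perimeter_asymptotics:
  fixes E \<Omega> :: "'a::euclidean_space set"
  assumes E: "E \<in> sets borel" and \<Omega>: "\<Omega> \<in> sets borel" "bounded \<Omega>"
    and s0: "0 < s0" "s0 \<le> 1" and fin: "s_perimeter s0 E \<Omega> < \<infinity>"
  defines "N \<equiv> real DIM('a) * unit_ball_vol (real DIM('a))"
    and "a1 \<equiv> measure lborel (E \<inter> \<Omega>)" and "a2 \<equiv> measure lborel (- E \<inter> \<Omega>)"
  shows "\<And>s. 0 < s \<Longrightarrow> s \<le> s0 \<Longrightarrow> s_perimeter s E \<Omega> < \<infinity>"
    and "((\<lambda>s. s * enn2real (s_perimeter s E \<Omega>) - (a1 * N + (a2 - a1) * (s * enn2real (tail_mass s E))))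
      \<longlongrightarrow> 0) (at_right 0)"
proof -
  define A1 A2 B2 B3 where "A1 = E \<inter> \<Omega>" and "A2 = - E \<inter> \<Omega>" and "B2 = - E \<inter> - \<Omega>" and "B3 = E \<inter> - \<Omega>"
  have meas: "A1 \<in> sets borel" "A2 \<in> sets borel" "B2 \<in> sets borel" "B3 \<in> sets borel"
    using E \<Omega> by (auto simp: A1_def A2_def B2_def B3_def)
  have bdd: "bounded A1" "bounded A2"
    using \<Omega>(2) by (auto simp: A1_def A2_def intro: bounded_subset)
  have per: "s_perimeter s E \<Omega> = interaction s A1 A2 + interaction s A1 B2 + interaction s A2 B3" for s
    unfolding s_perimeter_def using interaction_commute[OF meas(4,2), of s]
    by (simp add: A1_def A2_def B2_def B3_def)
  have fin': "interaction s0 A1 A2 < \<infinity>" "interaction s0 A1 B2 < \<infinity>" "interaction s0 A2 B3 < \<infinity>"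
    using fin unfolding per by (auto simp: less_top[symmetric])
  note as1 = interaction_asymptotics[OF meas(1,2) bdd(1) s0 fin'(1)]
  note as2 = interaction_asymptotics[OF meas(1,3) bdd(1) s0 fin'(2)]
  note as3 = interaction_asymptotics[OF meas(2,4) bdd(2) s0 fin'(3)]
  show "s_perimeter s E \<Omega> < \<infinity>" if "0 < s" "s \<le> s0" for s
    unfolding per using as1(1)[OF that] as2(1)[OF that] as3(1)[OF that] by (simp add: less_top[symmetric])
  define t where "t s B = enn2real (tail_mass s B)" for s and B :: "'a set"
  have fin_tail: "tail_mass s B < \<infinity>" if "0 < s" for s and B :: "'a set"
    by (rule le_less_trans[OF tail_mass_le[OF that]]) simp
  have t_Un: "t s (B \<union> C) = t s B + t s C"
    if "0 < s" "B \<in> sets borel" "C \<in> sets borel" "B \<inter> C = {}" for s and B C :: "'a set"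
    unfolding t_def tail_mass_Un[OF that(2-4)] using fin_tail[OF that(1)] by (intro enn2real_plus) auto
  have t_total: "s * t s E + s * t s (- E) = N" if "0 < s" for s
  proof -
    have "t s E + t s (- E) = t s UNIV"
      using t_Un[OF that, of E "- E"] E by simp
    also have "\<dots> = N / s"
      using nn_integral_radial_tail[OF that, where 'a='a] that
      by (simp add: t_def tail_mass_def N_def)
    finally show ?thesis using that by (simp add: field_simps)
  qed
  \<comment> \<open>The last summand completes the tail of \<open>B3\<close> to that of
    \<open>E = A1 \<union> B3\<close>; it tends to 0 because \<open>A1\<close> is bounded.\<close>
  have "((\<lambda>s. (s * enn2real (interaction s A1 A2) - a1 * (s * t s A2))
      + (s * enn2real (interaction s A1 B2) - a1 * (s * t s B2))
      + (s * enn2real (interaction s A2 B3) - a2 * (s * t s B3)) - a2 * (s * t s A1)) \<longlongrightarrow> 0 + 0 + 0 - a2 * 0) (at_right 0)"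
    unfolding t_def a1_def a2_def A1_def[symmetric] A2_def[symmetric]
    by (intro tendsto_intros as1(2) as2(2) as3(2) tendsto_tail_mass_bounded meas bdd)
  moreover have "\<forall>\<^sub>F s in at_right 0. (s * enn2real (interaction s A1 A2) - a1 * (s * t s A2))
      + (s * enn2real (interaction s A1 B2) - a1 * (s * t s B2))
      + (s * enn2real (interaction s A2 B3) - a2 * (s * t s B3)) - a2 * (s * t s A1)
      = s * enn2real (s_perimeter s E \<Omega>) - (a1 * N + (a2 - a1) * (s * enn2real (tail_mass s E)))"
    unfolding eventually_at_right_field
  proof (intro exI[of _ s0] conjI allI impI s0)
    fix s assume s: "0 < s" "s < s0"
    then have "s \<le> s0" by simp
    note f = as1(1)[OF s(1) this] as2(1)[OF s(1) this] as3(1)[OF s(1) this]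
    have P: "enn2real (s_perimeter s E \<Omega>)
        = enn2real (interaction s A1 A2) + enn2real (interaction s A1 B2) + enn2real (interaction s A2 B3)"
      unfolding per using f by (subst enn2real_plus; simp add: enn2real_plus less_top[symmetric])+
    have eqs: "- E = A2 \<union> B2" "E = A1 \<union> B3" by (auto simp: A1_def A2_def B2_def B3_def)
    have "t s (- E) = t s A2 + t s B2"
      unfolding eqs(1) by (rule t_Un[OF s(1) meas(2,3)]) (auto simp: A2_def B2_def)
    moreover have "t s E = t s A1 + t s B3"
      unfolding eqs(2) by (rule t_Un[OF s(1) meas(1,4)]) (auto simp: A1_def B3_def)
    ultimately have tE: "s * t s (- E) = s * t s A2 + s * t s B2" "s * t s E = s * t s A1 + s * t s B3"
      by (simp_all add: distrib_left)
    have N: "N = s * t s A1 + s * t s B3 + (s * t s A2 + s * t s B2)"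
      using t_total[OF s(1)] tE by simp
    show "(s * enn2real (interaction s A1 A2) - a1 * (s * t s A2))
      + (s * enn2real (interaction s A1 B2) - a1 * (s * t s B2))
      + (s * enn2real (interaction s A2 B3) - a2 * (s * t s B3)) - a2 * (s * t s A1)
      = s * enn2real (s_perimeter s E \<Omega>) - (a1 * N + (a2 - a1) * (s * enn2real (tail_mass s E)))"
      unfolding P N t_def[symmetric] tE(2) by (simp add: algebra_simps)
  qed
  ultimately show "((\<lambda>s. s * enn2real (s_perimeter s E \<Omega>) - (a1 * N + (a2 - a1) * (s * enn2real (tail_mass s E))))
      \<longlongrightarrow> 0) (at_right 0)"
    by (simp add: tendsto_cong)
qed

theorem theorem2p7:
  fixes \<Omega> E :: "(real ^ 'n) set" and \<gamma> :: real
  assumes "open \<Omega>" and "bounded \<Omega>"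
    and "0 < \<gamma>" and "\<gamma> < 1" and "C1_holder_boundary \<gamma> \<Omega>"
    and "E \<in> sets lebesgue"
    and "\<exists>s\<^sub>0. 0 < s\<^sub>0 \<and> s\<^sub>0 < 1 \<and> s_perimeter s\<^sub>0 E \<Omega> < \<infinity>"
  shows "(measure lebesgue (\<Omega> - E) = measure lebesgue (E \<inter> \<Omega>) \<longrightarrow>
            E \<in> limit_family \<Omega> \<and>
            limit_perimeter \<Omega> E = sphere_weighted_measure (E \<inter> \<Omega>)) \<and>
         (measure lebesgue (\<Omega> - E) \<noteq> measure lebesgue (E \<inter> \<Omega>) \<and> E \<in> limit_family \<Omega> \<longrightarrow>
            (\<exists>\<alpha>::real.
               ((\<lambda>s. s * (LINT y:(E \<inter> - ball 0 1)|lebesgue.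
                            1 / norm y powr (real CARD('n) + s))) \<longlongrightarrow> \<alpha>) (at_right 0) \<and>
               \<alpha> = (enn2real (limit_perimeter \<Omega> E)
                     - enn2real (sphere_weighted_measure (E \<inter> \<Omega>)))
                   / (measure lebesgue (\<Omega> - E) - measure lebesgue (E \<inter> \<Omega>))))"
proof -
  \<comment> \<open>A Borel set equal to \<open>E\<close> almost everywhere; measures, integrals and
    interactions are transferred to it, since the estimates are stated for Borel sets.\<close>
  define E' where "E' = main_part lborel E"
  have E': "E' \<in> sets borel"
    using main_part_sets[OF assms(6)] by (simp add: E'_def)
  have AE: "AE x in lborel. x \<in> E' \<longleftrightarrow> x \<in> E"
    unfolding E'_def by (rule AE_in_main_part[OF assms(6)])
  then have AE': "AE x in lebesgue. x \<in> E' \<longleftrightarrow> x \<in> E" by (rule AE_completion)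
  have \<Omega>: "\<Omega> \<in> sets borel" using assms(1) by simp
  obtain s0 where s0: "0 < s0" "s0 < 1" "s_perimeter s0 E \<Omega> < \<infinity>" using assms(7) by blast
  have per: "s_perimeter s E \<Omega> = s_perimeter s E' \<Omega>" for s
    unfolding s_perimeter_def using AE
    by (intro arg_cong2[where f = "(+)"] interaction_cong_AE; eventually_elim) auto
  have em: "emeasure lebesgue (E \<inter> \<Omega>) = emeasure lborel (E' \<inter> \<Omega>)" "emeasure lebesgue (\<Omega> - E) = emeasure lborel (- E' \<inter> \<Omega>)"
  proof -
    have "emeasure lebesgue (E \<inter> \<Omega>) = emeasure lebesgue (E' \<inter> \<Omega>)"
      using AE' assms(6) E' \<Omega> by (intro emeasure_eq_AE) auto
    then show "emeasure lebesgue (E \<inter> \<Omega>) = emeasure lborel (E' \<inter> \<Omega>)"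
      using E' \<Omega> by simp
    have "emeasure lebesgue (\<Omega> - E) = emeasure lebesgue (- E' \<inter> \<Omega>)"
      using AE' assms(6) E' \<Omega> by (intro emeasure_eq_AE) auto
    then show "emeasure lebesgue (\<Omega> - E) = emeasure lborel (- E' \<inter> \<Omega>)"
      using E' \<Omega> by simp
  qed
  \<comment> \<open>This holds for every \<open>s\<close>: if the nonnegative integrand is not
    integrable, both sides are 0, the left by convention and the right because
    \<open>enn2real\<close> sends infinity to 0.\<close>
  have LINT: "(LINT y:(E \<inter> - ball 0 1)|lebesgue. 1 / norm y powr (real CARD('n) + s)) = enn2real (tail_mass s E')" for s
  proof -
    have "(\<lambda>y::real ^ 'n. 1 / norm y powr (real CARD('n) + s)) \<in> borel_measurable lebesgue"
      by (rule measurable_completion) measurable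
    then have "(\<lambda>y. indicator (E \<inter> - ball 0 1) y *\<^sub>R (1 / norm y powr (real CARD('n) + s))) \<in> borel_measurable lebesgue"
      using assms(6) by (intro borel_measurable_scaleR borel_measurable_indicator) auto
    then have "(LINT y:(E \<inter> - ball 0 1)|lebesgue. 1 / norm y powr (real CARD('n) + s))
      = enn2real (\<integral>\<^sup>+y. ennreal (indicator (E \<inter> - ball 0 1) y *\<^sub>R (1 / norm y powr (real CARD('n) + s))) \<partial>lebesgue)"
      unfolding set_lebesgue_integral_def by (intro integral_eq_nn_integral) auto
    also have "(\<integral>\<^sup>+y. ennreal (indicator (E \<inter> - ball 0 1) y *\<^sub>R (1 / norm y powr (real CARD('n) + s))) \<partial>lebesgue)
      = tail_mass s E'"
      unfolding tail_mass_def nn_integral_completion using AE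
      by (intro nn_integral_cong_AE, eventually_elim) (simp add: indicator_def)
    finally show ?thesis .
  qed
  define N where "N = real CARD('n) * unit_ball_vol (real CARD('n))"
  define a1 a2 where "a1 = measure lborel (E' \<inter> \<Omega>)" and "a2 = measure lborel (- E' \<inter> \<Omega>)"
  define P where "P s = s * enn2real (s_perimeter s E \<Omega>)" for s
  define T where "T s = s * enn2real (tail_mass s E')" for s
  have a: "measure lebesgue (E \<inter> \<Omega>) = a1" "measure lebesgue (\<Omega> - E) = a2"
    using em by (simp_all add: measure_def a1_def a2_def)
  have "bounded (E' \<inter> \<Omega>)" using assms(2) by (rule bounded_subset) auto
  then have "emeasure lborel (E' \<inter> \<Omega>) = ennreal a1"
    using emeasure_bounded_finite[of "E' \<inter> \<Omega>"] by (simp add: a1_def emeasure_eq_ennreal_measure less_top)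
  then have swm: "sphere_weighted_measure (E \<inter> \<Omega>) = ennreal (a1 * N)"
    unfolding sphere_weighted_measure_def em
    by (simp add: hausdorff_measure_sphere[simplified] N_def ennreal_mult''[symmetric] mult.commute)
  have a1N: "0 \<le> a1 * N" by (simp add: a1_def N_def)
  have asym: "((\<lambda>s. P s - (a1 * N + (a2 - a1) * T s)) \<longlongrightarrow> 0) (at_right 0)"
    using s_perimeter_asymptotics(2)[OF E' \<Omega> assms(2) s0(1) less_imp_le[OF s0(2)] s0(3)[unfolded per]]
    by (simp add: P_def T_def N_def a1_def a2_def per)
  \<comment> \<open>The perimeter is finite for \<open>s < s0\<close>, so limits in
    \<open>ennreal\<close> and in the reals can be exchanged.\<close>
  have P: "\<forall>\<^sub>F s in at_right 0. ennreal s * s_perimeter s E \<Omega> = ennreal (P s)"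
    unfolding eventually_at_right_field
  proof (intro exI[of _ s0] conjI allI impI s0)
    fix s assume s: "0 < s" "s < s0"
    have "s_perimeter s E \<Omega> < \<infinity>"
      unfolding per using s
      by (intro s_perimeter_asymptotics(1)[OF E' \<Omega> assms(2) s0(1) less_imp_le[OF s0(2)] s0(3)[unfolded per]]) auto
    then have "s_perimeter s E \<Omega> = ennreal (enn2real (s_perimeter s E \<Omega>))" by (simp add: less_top)
    then show "ennreal s * s_perimeter s E \<Omega> = ennreal (P s)"
      unfolding P_def using s ennreal_mult'[of s "enn2real (s_perimeter s E \<Omega>)"] by simp
  qed
  \<comment> \<open>With \<open>a2 = a1\<close> the coefficient of \<open>T s\<close> in
    \<open>asym\<close> is zero.\<close>
  have i: "E \<in> limit_family \<Omega> \<and> limit_perimeter \<Omega> E = sphere_weighted_measure (E \<inter> \<Omega>)" if "a2 = a1"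
  proof -
    have "((\<lambda>s. (P s - (a1 * N + (a2 - a1) * T s)) + a1 * N) \<longlongrightarrow> 0 + a1 * N) (at_right 0)"
      by (intro tendsto_add asym tendsto_const)
    then have "(P \<longlongrightarrow> a1 * N) (at_right 0)" using that by simp
    then have "((\<lambda>s. ennreal (P s)) \<longlongrightarrow> ennreal (a1 * N)) (at_right 0)" by (rule tendsto_ennrealI)
    then have lim: "((\<lambda>s. ennreal s * s_perimeter s E \<Omega>) \<longlongrightarrow> ennreal (a1 * N)) (at_right 0)"
      using tendsto_cong[OF P] by simp
    have "E \<in> limit_family \<Omega>"
      unfolding limit_family_def using assms(6) lim by (auto intro!: exI[of _ "ennreal (a1 * N)"])
    moreover have "limit_perimeter \<Omega> E = ennreal (a1 * N)"
      unfolding limit_perimeter_def by (rule tendsto_Lim[OF _ lim]) simp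
    ultimately show ?thesis by (simp add: swm)
  qed
  have ii: "(T \<longlongrightarrow> (enn2real (limit_perimeter \<Omega> E) - enn2real (sphere_weighted_measure (E \<inter> \<Omega>))) / (a2 - a1)) (at_right 0)"
    if ne: "a2 \<noteq> a1" and fam: "E \<in> limit_family \<Omega>"
  proof -
    obtain m where m: "m < \<infinity>" "((\<lambda>s. ennreal s * s_perimeter s E \<Omega>) \<longlongrightarrow> m) (at_right 0)"
      using fam by (auto simp: limit_family_def)
    have lp: "limit_perimeter \<Omega> E = m"
      unfolding limit_perimeter_def by (rule tendsto_Lim[OF _ m(2)]) simp
    have "((\<lambda>s. ennreal (P s)) \<longlongrightarrow> ennreal (enn2real m)) (at_right 0)"
      using m tendsto_cong[OF P] by (simp add: less_top)
    \<comment> \<open>\<open>enn2real\<close> is continuous at the finite limit \<open>m\<close>,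
      which brings the convergence back to the reals.\<close>
    then have "((\<lambda>s. enn2real (ennreal (P s))) \<longlongrightarrow> enn2real (ennreal (enn2real m))) (at_right 0)"
      by (intro tendsto_enn2real) simp_all
    moreover have "\<forall>\<^sub>F s in at_right 0. enn2real (ennreal (P s)) = P s"
      using eventually_at_right_less[of "0::real"] by eventually_elim (simp add: P_def)
    ultimately have Pm: "(P \<longlongrightarrow> enn2real m) (at_right 0)"
      by (simp add: tendsto_cong)
    \<comment> \<open>This quotient is \<open>T s\<close> itself, as \<open>a2 - a1\<close> is
      nonzero; it is \<open>asym\<close> solved for \<open>T s\<close> in terms of functions whose
      limits are known.\<close>
    have "((\<lambda>s. (P s - (P s - (a1 * N + (a2 - a1) * T s)) - a1 * N) / (a2 - a1)) \<longlongrightarrow> (enn2real m - 0 - a1 * N) / (a2 - a1)) (at_right 0)"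
      using ne by (intro tendsto_divide tendsto_diff Pm asym tendsto_const) simp
    then show ?thesis using ne a1N by (simp add: lp swm)
  qed
  show ?thesis
    unfolding a LINT using i ii by (auto simp: T_def[abs_def])
qed

end
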